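(* Consider a chain of $N$ sites with one fermionic mode per site and Majorana operators $\gamma_{2n-1}=a_n^\dagger+a_n$, $\gamma_{2n}=i(a_n^\dagger-a_n)$. Let $$M^{n,m}=\tfrac{1}{\sqrt2}\,i^{m}\,(\sigma^x)^{n+m},\qquad \tilde M^{n,m}=\tfrac{1}{\sqrt2}(-i)^{m}(\sigma^x)^{n+m},\qquad n,m\in\{0,1\},$$ and $$M_{AP}^{(N)}=\sum \tfrac{1}{\sqrt2}\,\mathrm{tr}\left(M^{n_1,m_1}\cdots M^{n_N,m_N}\right)f_1^{n_1,m_1}\cdots f_N^{n_N,m_N},$$ $$M_{P}^{(N)}=\sum \tfrac{1}{\sqrt2}\,\mathrm{tr}\left(\sigma^x\tilde M^{n_1,m_1}\cdots \tilde M^{n_N,m_N}\right)f_1^{n_1,m_1}\cdots f_N^{n_N,m_N}.$$ Then for all $N\ge1$: (1) $M_{AP}^{(N)}$ and $M_P^{(N)}$ are unitary, and $M_{AP}^{(N)}\gamma_jM_{AP}^{(N)\dagger}=\gamma_{j+1}$, $M_{P}^{(N)}\gamma_jM_{P}^{(N)\dagger}=\gamma_{j+1}$ for $1\le j\le 2N-1$, while $M_{AP}^{(N)}\gamma_{2N}M_{AP}^{(N)\dagger}=-\gamma_1$ and $M_{P}^{(N)}\gamma_{2N}M_{P}^{(N)\dagger}=\gamma_1$. (2) These fermionic quantum cellular automata cannot be written as plain fermionic matrix product operators, not even after blocking: $M_P^{(N)}$ is not a plain periodic fMPO, and the family $(M_{AP}^{(N)})_N$ is not generated by any even tensor as a plain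 antiperiodic fMPO, also when groups of $k$ neighbouring sites are regarded as single sites, for any $k\ge1$.
   Context: $\sigma^x$ is the Pauli matrix. $a_n$ are fermionic annihilation operators with vacuum $|\Omega\rangle$; for $p_x\in\{0,1\}$ let $|p_1,\dots,p_N\rangle=(a_1^\dagger)^{p_1}\cdots(a_N^\dagger)^{p_N}|\Omega\rangle$, with parity $|p|=p$. The operators $f_x^{n,m}$ are $$f_x^{n,m}|p_1,\dots,p_N\rangle=\delta_{m,p_x}(-1)^{(|n|+|m|)\sum_{y<x}|p_y|}|p_1,\dots,p_{x-1},n,p_{x+1},\dots,p_N\rangle,$$ i.e. $f^{0,0}_x=a_xa_x^\dagger$, $f_x^{0,1}=a_x$, $f_x^{1,0}=a_x^\dagger$, $f_x^{1,1}=a_x^\dagger a_x$. For a general local graded space with homogeneous basis labelled by $n$ of parity $|n|$ (e.g. a block of $k$ sites, with $n=(n^{(1)},\dots,n^{(k)})$ and $|n|=\sum_i n^{(i)}\bmod 2$), $f_x^{n,m}$ is defined by the same formula. An even tensor consists of $D\times D$ matrices $U^{n,m}$ and a diagonal matrix $Z$ with entries $\pm1$ such that $ZU^{n,m}=(-1)^{|n|+|m|}U^{n,m}Z$. It generates the plain fMPO $\sum c\; f_1^{n_1,m_1}\cdots f_N^{n_N,m_N}$ with $c=\mathrm{tr}(Z\,U^{n_1,m_1}\cdots U^{n_N,m_N})$ in the periodic case and $c=\mathrm{tr}(U^{n_1,m_1}\cdots U^{n_N,m_N})$ in the antiperiodic case, the same tensor being used for all $N$. All sums run over all values of the indices. 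*)

theory Defs
  imports Complex_Main "Jordan_Normal_Form.Schur_Decomposition"
begin

definition mtrace :: "complex mat \<Rightarrow> complex" where
  "mtrace A = (\<Sum>i<dim_row A. A $$ (i, i))"

definition unitary_mat :: "nat \<Rightarrow> complex mat \<Rightarrow> bool" where
  "unitary_mat d A \<longleftrightarrow> A \<in> carrier_mat d d \<and>
     A * mat_adjoint A = 1\<^sub>m d \<and> mat_adjoint A * A = 1\<^sub>m d"

text \<open>Matrices of all sizes share one type, so sums and products over index sets take the
  size \<open>d\<close> as a parameter.\<close>

definition mat_prod :: "nat \<Rightarrow> complex mat list \<Rightarrow> complex mat" where
  "mat_prod d As = foldr (*) As (1\<^sub>m d)"

definition mat_Sum :: "nat \<Rightarrow> 's set \<Rightarrow> ('s \<Rightarrow> complex mat) \<Rightarrow> complex mat" where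
  "mat_Sum d S F = mat d d (\<lambda>(i, j). \<Sum>s\<in>S. F s $$ (i, j))"

text \<open>Sites are numbered \<open>1, \<dots>, N\<close>. The relations below are the canonical anticommutation
  relations, with vacuum \<open>\<Omega>\<close>; the dimension \<open>2 ^ N\<close> says that the state space
  is the Fock space of these \<open>N\<close> modes and carries no further degrees of freedom.\<close>

definition fermion_modes :: "nat \<Rightarrow> (nat \<Rightarrow> complex mat) \<Rightarrow> complex vec \<Rightarrow> bool" where
  "fermion_modes N a \<Omega> \<longleftrightarrow>
     (\<forall>x\<in>{1..N}. a x \<in> carrier_mat (2 ^ N) (2 ^ N)) \<and>
     (\<forall>x\<in>{1..N}. \<forall>y\<in>{1..N}. a x * a y + a y * a x = 0\<^sub>m (2 ^ N) (2 ^ N)) \<and>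
     (\<forall>x\<in>{1..N}. \<forall>y\<in>{1..N}. a x * mat_adjoint (a y) + mat_adjoint (a y) * a x =
        (if x = y then 1\<^sub>m (2 ^ N) else 0\<^sub>m (2 ^ N) (2 ^ N))) \<and>
     \<Omega> \<in> carrier_vec (2 ^ N) \<and> \<Omega> \<bullet>c \<Omega> = 1 \<and>
     (\<forall>x\<in>{1..N}. a x *\<^sub>v \<Omega> = 0\<^sub>v (2 ^ N))"

definition majorana :: "(nat \<Rightarrow> complex mat) \<Rightarrow> nat \<Rightarrow> complex mat" where
  "majorana a j =
     (if odd j then mat_adjoint (a ((j + 1) div 2)) + a ((j + 1) div 2)
      else \<i> \<cdot>\<^sub>m (mat_adjoint (a (j div 2)) - a (j div 2)))"

text \<open>The occupation number of site \<open>x\<close> is entry \<open>x - 1\<close> of the list \<open>ps\<close>.\<close>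

definition fock_ket :: "nat \<Rightarrow> (nat \<Rightarrow> complex mat) \<Rightarrow> complex vec \<Rightarrow> nat list \<Rightarrow> complex vec" where
  "fock_ket N a \<Omega> ps =
     mat_prod (2 ^ N) (map (\<lambda>x. mat_adjoint (a x) ^\<^sub>m (ps ! (x - 1))) [1..<N + 1]) *\<^sub>v \<Omega>"

definition configs :: "'l set \<Rightarrow> nat \<Rightarrow> 'l list set" where
  "configs B L = {ps. length ps = L \<and> set ps \<subseteq> B}"

text \<open>The local graded space has homogeneous basis labels \<open>B\<close> with parity \<open>par\<close>, and
  \<open>ket\<close> sends a configuration of \<open>L\<close> such sites to the corresponding
  vector of an orthonormal basis. The operator is written as a sum of
  \<open>|p\<^sub>1, \<dots>, n, \<dots>, p\<^sub>L\<rangle>\<langle>p\<^sub>1, \<dots>, p\<^sub>L|\<close>; its action on basis vectors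
  is shown in \<open>f_op_ket\<close> below.\<close>

definition f_op :: "nat \<Rightarrow> 'l set \<Rightarrow> ('l \<Rightarrow> nat) \<Rightarrow> ('l list \<Rightarrow> complex vec) \<Rightarrow> nat \<Rightarrow>
    nat \<Rightarrow> 'l \<Rightarrow> 'l \<Rightarrow> complex mat" where
  "f_op d B par ket L x n m = mat d d (\<lambda>(i, j).
     \<Sum>ps\<in>{ps \<in> configs B L. ps ! (x - 1) = m}.
       (- 1) ^ ((par n + par m) * (\<Sum>y=1..<x. par (ps ! (y - 1)))) *
       (ket (ps[x - 1 := n]) $ i * cnj (ket ps $ j)))"

definition f_sum :: "nat \<Rightarrow> 'l set \<Rightarrow> ('l \<Rightarrow> nat) \<Rightarrow> ('l list \<Rightarrow> complex vec) \<Rightarrow> nat \<Rightarrow>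
    ('l list \<Rightarrow> 'l list \<Rightarrow> complex) \<Rightarrow> complex mat" where
  "f_sum d B par ket L c =
     mat_Sum d (configs B L \<times> configs B L) (\<lambda>(ns, ms).
       c ns ms \<cdot>\<^sub>m
       mat_prod d (map (\<lambda>x. f_op d B par ket L x (ns ! (x - 1)) (ms ! (x - 1))) [1..<L + 1]))"

definition even_tensor :: "'l set \<Rightarrow> ('l \<Rightarrow> nat) \<Rightarrow> nat \<Rightarrow> complex mat \<Rightarrow>
    ('l \<Rightarrow> 'l \<Rightarrow> complex mat) \<Rightarrow> bool" where
  "even_tensor B par D Z U \<longleftrightarrow>
     Z \<in> carrier_mat D D \<and> diagonal_mat Z \<and> (\<forall>i<D. Z $$ (i, i) \<in> {1, - 1}) \<and>
     (\<forall>n\<in>B. \<forall>m\<in>B. U n m \<in> carrier_mat D D \<and>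
        Z * U n m = (- 1) ^ (par n + par m) \<cdot>\<^sub>m (U n m * Z))"

definition plain_periodic_fMPO :: "nat \<Rightarrow> 'l set \<Rightarrow> ('l \<Rightarrow> nat) \<Rightarrow> ('l list \<Rightarrow> complex vec) \<Rightarrow> nat \<Rightarrow>
    nat \<Rightarrow> complex mat \<Rightarrow> ('l \<Rightarrow> 'l \<Rightarrow> complex mat) \<Rightarrow> complex mat" where
  "plain_periodic_fMPO d B par ket L D Z U =
     f_sum d B par ket L (\<lambda>ns ms. mtrace (Z * mat_prod D (map2 U ns ms)))"

definition plain_antiperiodic_fMPO :: "nat \<Rightarrow> 'l set \<Rightarrow> ('l \<Rightarrow> nat) \<Rightarrow> ('l list \<Rightarrow> complex vec) \<Rightarrow>
    nat \<Rightarrow> nat \<Rightarrow> ('l \<Rightarrow> 'l \<Rightarrow> complex mat) \<Rightarrow> complex mat" where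
  "plain_antiperiodic_fMPO d B par ket L D U =
     f_sum d B par ket L (\<lambda>ns ms. mtrace (mat_prod D (map2 U ns ms)))"

abbreviation site_labels :: "nat set" where
  "site_labels \<equiv> {0, 1}"

definition site_parity :: "nat \<Rightarrow> nat" where
  "site_parity n = n"

definition block_labels :: "nat \<Rightarrow> nat list set" where
  "block_labels k = configs site_labels k"

definition block_parity :: "nat list \<Rightarrow> nat" where
  "block_parity n = sum_list n mod 2"

definition block_ket :: "nat \<Rightarrow> (nat \<Rightarrow> complex mat) \<Rightarrow> complex vec \<Rightarrow> nat list list \<Rightarrow> complex vec" where
  "block_ket N a \<Omega> ps = fock_ket N a \<Omega> (concat ps)"

definition sigma_x :: "complex mat" where
  "sigma_x = mat_of_rows_list 2 [[0, 1], [1, 0]]"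

definition M_tensor :: "nat \<Rightarrow> nat \<Rightarrow> complex mat" where
  "M_tensor n m = (complex_of_real (1 / sqrt 2) * \<i> ^ m) \<cdot>\<^sub>m (sigma_x ^\<^sub>m (n + m))"

definition M_tilde_tensor :: "nat \<Rightarrow> nat \<Rightarrow> complex mat" where
  "M_tilde_tensor n m = (complex_of_real (1 / sqrt 2) * (- \<i>) ^ m) \<cdot>\<^sub>m (sigma_x ^\<^sub>m (n + m))"

definition M_AP :: "nat \<Rightarrow> (nat \<Rightarrow> complex mat) \<Rightarrow> complex vec \<Rightarrow> complex mat" where
  "M_AP N a \<Omega> = f_sum (2 ^ N) site_labels site_parity (fock_ket N a \<Omega>) N
     (\<lambda>ns ms. complex_of_real (1 / sqrt 2) * mtrace (mat_prod 2 (map2 M_tensor ns ms)))"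

definition M_P :: "nat \<Rightarrow> (nat \<Rightarrow> complex mat) \<Rightarrow> complex vec \<Rightarrow> complex mat" where
  "M_P N a \<Omega> = f_sum (2 ^ N) site_labels site_parity (fock_ket N a \<Omega>) N
     (\<lambda>ns ms. complex_of_real (1 / sqrt 2) *
        mtrace (sigma_x * mat_prod 2 (map2 M_tilde_tensor ns ms)))"

lemma f_op_ket:
  assumes B: "finite B" and x: "x \<in> {1..L}" and n: "n \<in> B" and qs: "qs \<in> configs B L"
    and dim: "\<And>ps. ps \<in> configs B L \<Longrightarrow> ket ps \<in> carrier_vec d"
    and orth: "\<And>ps ps'. ps \<in> configs B L \<Longrightarrow> ps' \<in> configs B L \<Longrightarrow>
      ket ps \<bullet>c ket ps' = (if ps = ps' then 1 else 0)"
  shows "f_op d B par ket L x n m *\<^sub>v ket qs =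
    (if qs ! (x - 1) = m
     then (- 1) ^ ((par n + par m) * (\<Sum>y=1..<x. par (qs ! (y - 1)))) \<cdot>\<^sub>v ket (qs[x - 1 := n])
     else 0\<^sub>v d)"
proof -
  let ?S = "{ps \<in> configs B L. ps ! (x - 1) = m}"
  let ?s = "\<lambda>ps. (- 1) ^ ((par n + par m) * (\<Sum>y=1..<x. par (ps ! (y - 1)))) :: complex"
  have "configs B L = {xs. set xs \<subseteq> B \<and> length xs = L}"
    by (auto simp: configs_def)
  then have fin: "finite ?S"
    using finite_lists_length_eq[OF B, of L] finite_subset[of ?S "configs B L"] by auto
  have upd: "qs[x - 1 := n] \<in> configs B L"
    using qs n set_update_subset_insert[of qs "x - 1" n] by (auto simp: configs_def)
  have kq: "ket qs \<in> carrier_vec d" and ku: "ket (qs[x - 1 := n]) \<in> carrier_vec d"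
    using dim qs upd by auto
  have ip: "(\<Sum>j<d. cnj (ket ps $ j) * ket qs $ j) = (if ps = qs then 1 else 0)"
    if "ps \<in> configs B L" for ps
  proof -
    have "(\<Sum>j<d. cnj (ket ps $ j) * ket qs $ j) = ket qs \<bullet>c ket ps"
      using dim[OF that] by (simp add: scalar_prod_def lessThan_atLeast0 mult.commute)
    then show ?thesis using orth[OF qs that] by auto
  qed
  have ent: "(f_op d B par ket L x n m *\<^sub>v ket qs) $ i =
      (if qs ! (x - 1) = m then ?s qs * ket (qs[x - 1 := n]) $ i else 0)" if i: "i < d" for i
  proof -
    have "(f_op d B par ket L x n m *\<^sub>v ket qs) $ i =
        (\<Sum>j<d. (\<Sum>ps\<in>?S. ?s ps * (ket (ps[x - 1 := n]) $ i * cnj (ket ps $ j))) * ket qs $ j)"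
      using i kq by (simp add: f_op_def scalar_prod_def lessThan_atLeast0)
    also have "\<dots> = (\<Sum>ps\<in>?S. \<Sum>j<d. ?s ps * (ket (ps[x - 1 := n]) $ i * cnj (ket ps $ j)) * ket qs $ j)"
      by (subst sum.swap) (simp add: sum_distrib_right)
    also have "\<dots> = (\<Sum>ps\<in>?S. ?s ps * ket (ps[x - 1 := n]) $ i *
        (\<Sum>j<d. cnj (ket ps $ j) * ket qs $ j))"
      by (simp add: sum_distrib_left mult.assoc)
    also have "\<dots> = (\<Sum>ps\<in>?S. ?s ps * ket (ps[x - 1 := n]) $ i * (if ps = qs then 1 else 0))"
      by (intro sum.cong refl arg_cong2[where f = "(*)"] ip) simp
    also have "\<dots> = (\<Sum>ps\<in>?S. if ps = qs then ?s ps * ket (ps[x - 1 := n]) $ i else 0)"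
      by (intro sum.cong) auto
    also have "\<dots> = (if qs \<in> ?S then ?s qs * ket (qs[x - 1 := n]) $ i else 0)"
      using fin by (subst sum.delta) simp_all
    finally show ?thesis using qs by simp
  qed
  show ?thesis
    by (rule eq_vecI) (use ent ku in \<open>auto simp: f_op_def\<close>)
qed

end

theory Submission
  imports Defs
begin

text \<open>In the Fock basis, the matrix entry of \<open>\<Sum> c ns ms f\<^sub>1 \<cdots> f\<^sub>N\<close> at \<open>(ns, ms)\<close> is
  \<open>c ns ms\<close> times a sign that does not depend on \<open>c\<close>.
  A Majorana operator flips one occupation number up to a phase, which turns
  \<open>M \<gamma>\<^sub>j = \<gamma>\<^sub>j\<^sub>+\<^sub>1 M\<close> into a comparison of two entries of \<open>M\<close>; the columns of \<open>M\<close> are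
  orthogonal because flipping two adjacent occupation numbers reverses the sign of the summands.

  \<open>M_P\<close> has a nonzero entry of odd total parity, where \<open>tr (Z U \<cdots> U)\<close> vanishes since \<open>Z\<close>
  anticommutes with \<open>U \<cdots> U\<close>. If an antiperiodic tensor generated \<open>M_AP\<close>, its vacuum entry
  \<open>W = U 0 0\<close> would satisfy \<open>tr (W\<^sup>L) = sqrt 2 * r\<^sup>L\<close> for all \<open>L \<ge> 1\<close>, so \<open>r\<close> would be an
  eigenvalue of \<open>W\<close> of multiplicity \<open>sqrt 2\<close>.\<close>

subsection \<open>Traces, eigenvalues and matrix elements\<close>

text \<open>The fermionic signs are non-local: changing one occupation of a column label also
  affects the signs at every site to its right. Entries are therefore kept as powers of
  \<open>- 1\<close> in partial occupation sums, and a selection rule tames them: an entry is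
  nonzero only if the total parity of row and column is even (antiperiodic) or odd (periodic). One
  flip, of the row or of the column, leads to the opposite parity, where this rule fixes the total
  sign left over. For the last Majorana operator that fixed sign is the boundary sign.

  The constant sqrt 2 is 2 / sqrt 2, the trace of the identity on the two-dimensional bond space
  times the prefactor; the same prefactor normalises the columns, each with 2^(N-1) nonzero entries
  of squared modulus 2^(1-N).

  The periodic obstruction works at each single length, even for a tensor chosen for that length.
  The antiperiodic one compares all lengths, because an eigenvalue multiplicity is read off from the
  whole sequence of traces. Blocking changes neither: parities add over blocks, and \<open>r\<close>
  becomes \<open>r ^ k\<close>.\<close>

lemma mat_adjoint_carrier [simp]: "A \<in> carrier_mat n m \<Longrightarrow> mat_adjoint A \<in> carrier_mat m n"
  by (auto simp: mat_adjoint_def mat_of_rows_def)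

lemma mat_adjoint_index:
  "i < dim_col A \<Longrightarrow> j < dim_row A \<Longrightarrow> mat_adjoint A $$ (i, j) = conjugate (A $$ (j, i))"
  by (simp add: mat_adjoint_def mat_of_rows_def)

lemma mat_adjoint_dim [simp]:
  "dim_row (mat_adjoint A) = dim_col A" "dim_col (mat_adjoint A) = dim_row A"
  by (simp_all add: mat_adjoint_def mat_of_rows_def)

lemma mat_prod_Nil [simp]: "mat_prod d [] = 1\<^sub>m d"
  by (simp add: mat_prod_def)

lemma mat_prod_Cons [simp]: "mat_prod d (A # As) = A * mat_prod d As"
  by (simp add: mat_prod_def)

lemma mat_prod_carrier:
  "(\<And>A. A \<in> set As \<Longrightarrow> A \<in> carrier_mat d d) \<Longrightarrow> mat_prod d As \<in> carrier_mat d d"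
  by (induction As) (auto intro!: mult_carrier_mat)

lemma mtrace_comm:
  assumes "A \<in> carrier_mat n m" "B \<in> carrier_mat m n"
  shows "mtrace (A * B) = mtrace (B * A)"
proof -
  have "mtrace (A * B) = (\<Sum>i<n. \<Sum>j<m. A $$ (i, j) * B $$ (j, i))"
    using assms by (auto simp: mtrace_def scalar_prod_def lessThan_atLeast0 intro!: sum.cong)
  also have "\<dots> = (\<Sum>j<m. \<Sum>i<n. B $$ (j, i) * A $$ (i, j))"
    by (subst sum.swap) (simp add: mult.commute)
  also have "\<dots> = mtrace (B * A)"
    using assms by (auto simp: mtrace_def scalar_prod_def lessThan_atLeast0 intro!: sum.cong)
  finally show ?thesis .
qed

lemma mtrace_smult: "mtrace (c \<cdot>\<^sub>m A) = c * mtrace A" if "A \<in> carrier_mat n n"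
  using that by (auto simp: mtrace_def sum_distrib_left)

lemma mat_prod_replicate:
  assumes A: "A \<in> carrier_mat d d"
  shows "mat_prod d (replicate L A) = A ^\<^sub>m L"
proof -
  \<comment> \<open>\<open>mat_prod\<close> attaches new factors on the left, the matrix power on
    the right.\<close>
  have comm: "A * A ^\<^sub>m k = A ^\<^sub>m k * A" for k
  proof (induction k)
    case 0
    show ?case using A by simp
  next
    case (Suc k)
    have "A * (A ^\<^sub>m k * A) = A * A ^\<^sub>m k * A"
      using A by (simp add: assoc_mult_mat[of A d d _ d _ d])
    then show ?case using Suc by simp
  qed
  show ?thesis
    by (induction L) (use A comm in auto)
qed

lemma upper_triangular_pow:
  fixes B :: "'a :: comm_semiring_1 mat"
  assumes B: "B \<in> carrier_mat n n" and ut: "upper_triangular B"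
  shows "upper_triangular (B ^\<^sub>m L) \<and> (\<forall>i<n. (B ^\<^sub>m L) $$ (i, i) = (B $$ (i, i)) ^ L)"
proof (induction L)
  case 0
  show ?case using B by (auto simp: upper_triangular_def)
next
  case (Suc L)
  have C: "B ^\<^sub>m L \<in> carrier_mat n n" using B by simp
  have entry: "(B ^\<^sub>m L * B) $$ (i, j) = (\<Sum>k<n. (B ^\<^sub>m L) $$ (i, k) * B $$ (k, j))"
    if "i < n" "j < n" for i j
    using that B C by (auto simp: scalar_prod_def lessThan_atLeast0)
  have low: "(B ^\<^sub>m L) $$ (i, k) = 0" if "k < i" "i < n" for i k
    using Suc that C by (auto simp: upper_triangular_def)
  have lowB: "B $$ (i, k) = 0" if "k < i" "i < n" for i k
    using ut that B by (auto simp: upper_triangular_def)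
  have "(B ^\<^sub>m L * B) $$ (i, j) = 0" if "j < i" "i < n" for i j
  proof -
    \<comment> \<open>Below the diagonal, \<open>k < i\<close> kills the first factor, and
      \<open>k \<ge> i > j\<close> kills the second.\<close>
    have "(B ^\<^sub>m L) $$ (i, k) * B $$ (k, j) = 0" if "k < n" for k
      using low[of k i] lowB[of j k] that \<open>j < i\<close> \<open>i < n\<close> by (cases "k < i") auto
    then show ?thesis using that by (subst entry) auto
  qed
  moreover have "(B ^\<^sub>m L * B) $$ (i, i) = (B $$ (i, i)) ^ Suc L" if i: "i < n" for i
  proof -
    have "(\<Sum>k<n. (B ^\<^sub>m L) $$ (i, k) * B $$ (k, i)) =
        (\<Sum>k<n. if k = i then (B ^\<^sub>m L) $$ (i, k) * B $$ (k, i) else 0)"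
    proof (rule sum.cong)
      fix k assume "k \<in> {..<n}"
      then show "(B ^\<^sub>m L) $$ (i, k) * B $$ (k, i) =
          (if k = i then (B ^\<^sub>m L) $$ (i, k) * B $$ (k, i) else 0)"
        using low[of k i] lowB[of i k] i by (cases k i rule: linorder_cases) auto
    qed simp
    also have "\<dots> = (B $$ (i, i)) ^ Suc L"
      using Suc i by (simp add: mult.commute)
    finally show ?thesis using entry[OF i i] by simp
  qed
  ultimately show ?case using B C by (auto simp: upper_triangular_def)
qed

text \<open>Schur triangularisation over the complex numbers: similarity preserves the trace of
  every power, and the numbers \<open>ev i\<close> are the diagonal of the triangular form, so they
  repeat with algebraic multiplicity.\<close>

lemma mtrace_pow_eigenvalues:
  assumes A: "A \<in> carrier_mat n n"
  obtains ev :: "nat \<Rightarrow> complex" where "\<And>L. mtrace (A ^\<^sub>m L) = (\<Sum>i<n. ev i ^ L)"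
proof -
  obtain es where "char_poly A = (\<Prod>a\<leftarrow>es. [:- a, 1:])"
    using char_poly_factorized[OF A] by auto
  from schur_decomposition_exists[OF A this] obtain B where
    B: "B \<in> carrier_mat n n" "upper_triangular B" "similar_mat A B" by auto
  then obtain P Q where wit: "similar_mat_wit A B P Q" by (auto simp: similar_mat_def)
  from similar_mat_witD2[OF A wit] have
    PQ: "P \<in> carrier_mat n n" "Q \<in> carrier_mat n n" "Q * P = 1\<^sub>m n" by auto
  have "mtrace (A ^\<^sub>m L) = (\<Sum>i<n. (B $$ (i, i)) ^ L)" for L
  proof -
    have C: "B ^\<^sub>m L \<in> carrier_mat n n" using B by simp
    have "mtrace (A ^\<^sub>m L) = mtrace (P * (B ^\<^sub>m L * Q))"
      using similar_mat_wit_pow_id[OF wit, of L] PQ C by (simp add: assoc_mult_mat[of P n n _ n _ n])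
    also have "\<dots> = mtrace (B ^\<^sub>m L * Q * P)"
      using PQ C by (intro mtrace_comm[where m = n]) auto
    also have "B ^\<^sub>m L * Q * P = B ^\<^sub>m L"
      using PQ C by (simp add: assoc_mult_mat[of _ n n _ n _ n] right_mult_one_mat[OF C])
    also have "mtrace (B ^\<^sub>m L) = (\<Sum>i<n. (B $$ (i, i)) ^ L)"
      using upper_triangular_pow[OF B(1,2), of L] C by (auto simp: mtrace_def)
    finally show ?thesis .
  qed
  then show ?thesis by (rule that)
qed

text \<open>A polynomial without constant term that vanishes at every \<open>ev i \<noteq> r\<close>, but not at
  \<open>r\<close>, turns the identity of power sums into a formula for the multiplicity of \<open>r\<close>.\<close>

lemma power_sum_multiplicity:
  fixes ev :: "nat \<Rightarrow> complex"
  assumes r: "r \<noteq> 0" and pow: "\<And>L. L \<ge> 1 \<Longrightarrow> (\<Sum>i<n. ev i ^ L) = c * r ^ L"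
  shows "c = of_nat (card {i. i < n \<and> ev i = r})"
proof -
  define q where "q = (\<Prod>\<mu>\<in>ev ` {..<n} - {r}. [:- \<mu>, 1:])"
  \<comment> \<open>The extra factor X removes the constant coefficient, since the power sums are
    known only for \<open>L \<ge> 1\<close>. It vanishes at 0, which is why
    \<open>r \<noteq> 0\<close> is required for \<open>poly p r \<noteq> 0\<close>.\<close>
  define p where "p = pCons 0 q"
  have root: "poly p (ev i) = 0" if "i < n" "ev i \<noteq> r" for i
    using that by (auto simp: p_def q_def poly_prod)
  have "poly q r \<noteq> 0"
    by (auto simp: q_def poly_prod)
  then have pr: "poly p r \<noteq> 0" using r by (simp add: p_def)
  have "(\<Sum>i<n. poly p (ev i)) = (\<Sum>j\<le>degree p. coeff p j * (\<Sum>i<n. ev i ^ j))"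
    by (simp add: poly_altdef sum_distrib_left) (rule sum.swap)
  also have "\<dots> = (\<Sum>j\<le>degree p. c * (coeff p j * r ^ j))"
  proof (rule sum.cong)
    fix j
    show "coeff p j * (\<Sum>i<n. ev i ^ j) = c * (coeff p j * r ^ j)"
      using pow[of j] by (cases j) (auto simp: p_def)
  qed simp
  also have "\<dots> = c * poly p r"
    by (simp add: poly_altdef sum_distrib_left)
  finally have "c * poly p r = (\<Sum>i<n. poly p (ev i))" ..
  also have "\<dots> = (\<Sum>i<n. if ev i = r then poly p r else 0)"
    using root by (intro sum.cong) auto
  also have "\<dots> = of_nat (card {i. i < n \<and> ev i = r}) * poly p r"
    by (simp add: sum.If_cases Int_def)
  finally show ?thesis using pr by simp
qed

lemma sqrt_2_not_nat: "sqrt 2 \<noteq> real n"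
proof
  assume "sqrt 2 = real n"
  then have "real (n ^ 2) = real 2"
    by (metis of_nat_numeral of_nat_power real_sqrt_pow2 zero_le_numeral)
  then have "n ^ 2 = 2" using of_nat_eq_iff by blast
  moreover have "n < 2"
  proof (rule ccontr)
    assume "\<not> n < 2"
    then have "2 * 2 \<le> n * n" by (intro mult_le_mono) auto
    with \<open>n ^ 2 = 2\<close> show False by (simp add: power2_eq_square)
  qed
  ultimately show False by (auto simp: less_2_cases_iff)
qed

lemma mtrace_pow_neq_sqrt_2:
  assumes A: "A \<in> carrier_mat n n" and r: "r \<noteq> 0"
    and tr: "\<And>L. L \<ge> 1 \<Longrightarrow> mtrace (A ^\<^sub>m L) = complex_of_real (sqrt 2) * r ^ L"
  shows False
proof -
  obtain ev where "\<And>L. mtrace (A ^\<^sub>m L) = (\<Sum>i<n. ev i ^ L)"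
    using mtrace_pow_eigenvalues[OF A] by blast
  with tr have "complex_of_real (sqrt 2) = of_nat (card {i. i < n \<and> ev i = r})"
    by (intro power_sum_multiplicity[OF r]) auto
  then have "sqrt 2 = real (card {i. i < n \<and> ev i = r})"
    by (metis of_real_eq_iff of_real_of_nat_eq)
  with sqrt_2_not_nat show False by blast
qed

section \<open>Matrix elements with respect to an orthonormal basis\<close>

text \<open>This is \<open><v|A|w>\<close>: the middle argument is the bra, because
  \<open>\<bullet>c\<close> conjugates its right-hand vector.\<close>

definition mat_elem :: "complex mat \<Rightarrow> complex vec \<Rightarrow> complex vec \<Rightarrow> complex" where
  "mat_elem A v w = (A *\<^sub>v w) \<bullet>c v"

lemma mat_elem_sum:
  assumes "A \<in> carrier_mat d d" "v \<in> carrier_vec d" "w \<in> carrier_vec d"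
  shows "mat_elem A v w = (\<Sum>i<d. \<Sum>j<d. cnj (v $ i) * A $$ (i, j) * w $ j)"
  using assms by (auto simp: mat_elem_def scalar_prod_def lessThan_atLeast0 sum_distrib_right
      sum_distrib_left mult_ac intro!: sum.cong)

lemma cscalar_prod_adjoint:
  fixes A :: "complex mat"
  assumes "A \<in> carrier_mat d d" "v \<in> carrier_vec d" "w \<in> carrier_vec d"
  shows "(mat_adjoint A *\<^sub>v w) \<bullet>c v = w \<bullet>c (A *\<^sub>v v)"
proof -
  have "(mat_adjoint A *\<^sub>v w) \<bullet>c v = (\<Sum>i<d. \<Sum>j<d. cnj (v $ i) * cnj (A $$ (j, i)) * w $ j)"
    using mat_elem_sum[of "mat_adjoint A" d v w] assms
    by (auto simp: mat_elem_def mat_adjoint_index intro!: sum.cong)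
  also have "\<dots> = (\<Sum>j<d. \<Sum>i<d. cnj (v $ i) * cnj (A $$ (j, i)) * w $ j)"
    by (rule sum.swap)
  also have "\<dots> = w \<bullet>c (A *\<^sub>v v)"
    using assms by (auto simp: scalar_prod_def lessThan_atLeast0 sum_distrib_left mult_ac
        intro!: sum.cong)
  finally show ?thesis .
qed

lemma mat_elem_adjoint:
  assumes "A \<in> carrier_mat d d" "v \<in> carrier_vec d" "w \<in> carrier_vec d"
  shows "mat_elem (mat_adjoint A) v w = cnj (mat_elem A w v)"
proof -
  have "mat_elem (mat_adjoint A) v w = w \<bullet>c (A *\<^sub>v v)"
    unfolding mat_elem_def by (rule cscalar_prod_adjoint[OF assms])
  also have "\<dots> = cnj ((A *\<^sub>v v) \<bullet>c w)"
    using assms by (auto simp: scalar_prod_def mult.commute)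
  finally show ?thesis by (simp add: mat_elem_def)
qed

lemma mat_elem_mat_Sum:
  assumes "v \<in> carrier_vec d" "w \<in> carrier_vec d" "\<And>s. s \<in> S \<Longrightarrow> F s \<in> carrier_mat d d"
  shows "mat_elem (mat_Sum d S F) v w = (\<Sum>s\<in>S. mat_elem (F s) v w)"
proof -
  have "mat_Sum d S F \<in> carrier_mat d d" by (simp add: mat_Sum_def)
  then have "mat_elem (mat_Sum d S F) v w =
      (\<Sum>i<d. \<Sum>j<d. \<Sum>s\<in>S. cnj (v $ i) * F s $$ (i, j) * w $ j)"
    using assms by (simp add: mat_elem_sum[of _ d])
      (auto simp: mat_Sum_def sum_distrib_left sum_distrib_right intro!: sum.cong)
  also have "\<dots> = (\<Sum>s\<in>S. \<Sum>i<d. \<Sum>j<d. cnj (v $ i) * F s $$ (i, j) * w $ j)"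
    by (simp add: sum.swap[of _ S])
  also have "\<dots> = (\<Sum>s\<in>S. mat_elem (F s) v w)"
    using assms by (simp add: mat_elem_sum[of _ d])
  finally show ?thesis .
qed

text \<open>Orthonormality alone suffices to read off the entries of an fMPO, for single sites and
  for blocks alike. Completeness, needed for products and for equality of operators, is added in
  \<open>ket_basis\<close> through the cardinality.\<close>

locale kets =
  fixes d :: nat and C :: "'l set" and ket :: "'l \<Rightarrow> complex vec"
  assumes dim: "\<And>p. p \<in> C \<Longrightarrow> ket p \<in> carrier_vec d"
    and orth: "\<And>p q. p \<in> C \<Longrightarrow> q \<in> C \<Longrightarrow> ket p \<bullet>c ket q = (if p = q then 1 else 0)"

locale ket_basis = kets +
  assumes finC: "finite C" and cardC: "card C = d"
begin

text \<open>The kets are the columns of a square matrix \<open>V\<close>. Orthonormality says that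
  the adjoint of \<open>V\<close> is a left inverse, hence also a right inverse, and the latter is
  the resolution of the identity.\<close>

lemma complete:
  assumes i: "i < d" and j: "j < d"
  shows "(\<Sum>q\<in>C. ket q $ i * cnj (ket q $ j)) = (if i = j then 1 else 0)"
proof -
  obtain e where e: "bij_betw e {0..<d} C"
    using ex_bij_betw_nat_finite[OF finC] cardC by auto
  define V where "V = mat d d (\<lambda>(i, c). ket (e c) $ i)"
  have V: "V \<in> carrier_mat d d" by (simp add: V_def)
  have eC: "e c \<in> C" if "c < d" for c using e that by (auto simp: bij_betw_def)
  have "mat_adjoint V * V = 1\<^sub>m d"
  proof (rule eq_matI)
    fix b c assume "b < dim_row (1\<^sub>m d :: complex mat)" "c < dim_col (1\<^sub>m d :: complex mat)"
    then have bc: "b < d" "c < d" by auto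
    have "(mat_adjoint V * V) $$ (b, c) = ket (e c) \<bullet>c ket (e b)"
      using bc V eC dim by (auto simp: scalar_prod_def mat_adjoint_index V_def mult.commute
          carrier_vecD[OF dim] intro!: sum.cong)
    also have "\<dots> = (if b = c then 1 else 0)"
      using orth[OF eC eC, of c b] bc e by (auto simp: bij_betw_def inj_on_def)
    finally show "(mat_adjoint V * V) $$ (b, c) = 1\<^sub>m d $$ (b, c)" using bc by simp
  qed (use V in auto)
  then have "V * mat_adjoint V = 1\<^sub>m d"
    using mat_mult_left_right_inverse[OF mat_adjoint_carrier[OF V] V] by simp
  then have "(V * mat_adjoint V) $$ (i, j) = (if i = j then 1 else 0)"
    using i j by simp
  moreover have "(V * mat_adjoint V) $$ (i, j) = (\<Sum>c\<in>{0..<d}. ket (e c) $ i * cnj (ket (e c) $ j))"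
    using i j V by (auto simp: scalar_prod_def mat_adjoint_index V_def intro!: sum.cong)
  ultimately show ?thesis
    using sum.reindex_bij_betw[OF e, of "\<lambda>q. ket q $ i * cnj (ket q $ j)"] by simp
qed

lemma mat_elem_mult:
  assumes A: "A \<in> carrier_mat d d" and B: "B \<in> carrier_mat d d"
    and v: "v \<in> carrier_vec d" and w: "w \<in> carrier_vec d"
  shows "mat_elem (A * B) v w = (\<Sum>q\<in>C. mat_elem A v (ket q) * mat_elem B (ket q) w)"
proof -
  have Bw: "B *\<^sub>v w \<in> carrier_vec d" using B w by simp
  have expand: "(B *\<^sub>v w) $ j = (\<Sum>q\<in>C. ket q $ j * mat_elem B (ket q) w)" if j: "j < d" for j
  proof -
    have "(\<Sum>q\<in>C. ket q $ j * mat_elem B (ket q) w) =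
        (\<Sum>q\<in>C. \<Sum>l<d. (B *\<^sub>v w) $ l * (ket q $ j * cnj (ket q $ l)))"
      by (intro sum.cong refl)
        (auto simp: mat_elem_def scalar_prod_def lessThan_atLeast0 carrier_vecD[OF dim]
          sum_distrib_left mult_ac simp del: index_mult_mat_vec intro!: sum.cong)
    also have "\<dots> = (\<Sum>l<d. (B *\<^sub>v w) $ l * (\<Sum>q\<in>C. ket q $ j * cnj (ket q $ l)))"
      by (subst sum.swap) (simp add: sum_distrib_left)
    also have "\<dots> = (\<Sum>l<d. if l = j then (B *\<^sub>v w) $ l else 0)"
      by (intro sum.cong refl) (use j in \<open>simp add: complete\<close>)
    finally show ?thesis using j by simp
  qed
  have "mat_elem (A * B) v w = mat_elem A v (B *\<^sub>v w)"
    using assoc_mult_mat_vec[OF A B w] by (simp add: mat_elem_def)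
  also have "\<dots> = (\<Sum>i<d. \<Sum>j<d. \<Sum>q\<in>C. cnj (v $ i) * A $$ (i, j) * ket q $ j * mat_elem B (ket q) w)"
    unfolding mat_elem_sum[OF A v Bw]
    by (intro sum.cong refl) (simp add: expand sum_distrib_left mult.assoc del: index_mult_mat_vec)
  also have "\<dots> = (\<Sum>q\<in>C. \<Sum>i<d. \<Sum>j<d. cnj (v $ i) * A $$ (i, j) * ket q $ j * mat_elem B (ket q) w)"
    by (simp add: sum.swap[of _ C])
  also have "\<dots> = (\<Sum>q\<in>C. mat_elem A v (ket q) * mat_elem B (ket q) w)"
    by (intro sum.cong refl) (simp add: mat_elem_sum[OF A v dim] sum_distrib_right)
  finally show ?thesis .
qed

text \<open>The resolution of the identity on both sides, \<open>X = \<Sum> |p><p|X|q><q|\<close>,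
  recovers every matrix entry from the matrix elements.\<close>

lemma mat_elem_ext:
  assumes A: "A \<in> carrier_mat d d" and B: "B \<in> carrier_mat d d"
    and eq: "\<And>p q. p \<in> C \<Longrightarrow> q \<in> C \<Longrightarrow> mat_elem A (ket p) (ket q) = mat_elem B (ket p) (ket q)"
  shows "A = B"
proof -
  have entry: "X $$ (i, j) = (\<Sum>p\<in>C. \<Sum>q\<in>C. ket p $ i * mat_elem X (ket p) (ket q) * cnj (ket q $ j))"
    if X: "X \<in> carrier_mat d d" and ij: "i < d" "j < d" for X i j
  proof -
    have "(\<Sum>p\<in>C. \<Sum>q\<in>C. ket p $ i * mat_elem X (ket p) (ket q) * cnj (ket q $ j)) =
       (\<Sum>p\<in>C. \<Sum>q\<in>C. \<Sum>k<d. \<Sum>l<d. X $$ (k, l) * (ket p $ i * cnj (ket p $ k)) *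
          (ket q $ l * cnj (ket q $ j)))"
      by (intro sum.cong refl)
        (simp add: mat_elem_sum[OF X dim dim] sum_distrib_left sum_distrib_right mult_ac)
    also have "\<dots> = (\<Sum>k<d. \<Sum>l<d. \<Sum>p\<in>C. \<Sum>q\<in>C. X $$ (k, l) * (ket p $ i * cnj (ket p $ k)) *
          (ket q $ l * cnj (ket q $ j)))"
      by (simp add: sum.swap[of _ "{..<d}" C])
    also have "\<dots> = (\<Sum>k<d. \<Sum>l<d. X $$ (k, l) * (\<Sum>p\<in>C. ket p $ i * cnj (ket p $ k)) *
          (\<Sum>q\<in>C. ket q $ l * cnj (ket q $ j)))"
      by (simp add: sum_distrib_left sum_distrib_right mult_ac)
    also have "\<dots> = (\<Sum>k<d. \<Sum>l<d. if l = j then if k = i then X $$ (k, l) else 0 else 0)"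
      by (intro sum.cong refl) (use ij in \<open>auto simp: complete\<close>)
    also have "\<dots> = X $$ (i, j)" using ij by simp
    finally show ?thesis ..
  qed
  show ?thesis
  proof (rule eq_matI)
    fix i j assume "i < dim_row B" "j < dim_col B"
    then have ij: "i < d" "j < d" using B by auto
    show "A $$ (i, j) = B $$ (i, j)"
      unfolding entry[OF A ij] entry[OF B ij] by (intro sum.cong refl) (simp add: eq)
  qed (use A B in auto)
qed

end

subsection \<open>Fermionic matrix product operators\<close>

lemma configs_nth: "ps \<in> configs B L \<Longrightarrow> i < L \<Longrightarrow> ps ! i \<in> B"
  by (auto simp: configs_def)

lemma configs_length: "ps \<in> configs B L \<Longrightarrow> length ps = L"
  by (simp add: configs_def)

lemma configs_update: "ps \<in> configs B L \<Longrightarrow> b \<in> B \<Longrightarrow> ps[i := b] \<in> configs B L"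
  using set_update_subset_insert[of ps i b] by (auto simp: configs_def)

lemma finite_configs: "finite B \<Longrightarrow> finite (configs B L)"
  using finite_lists_length_eq[of B L] by (simp add: configs_def conj_commute)

lemma card_configs: "finite B \<Longrightarrow> card (configs B L) = card B ^ L"
  using card_lists_length_eq[of B L] by (simp add: configs_def conj_commute)

text \<open>In the product of the local operators the rightmost site acts first, so when site
  \<open>x\<close> is reached all sites to its left still carry the column labels \<open>ms\<close>.
  Positions count from 0 here, whereas the sites of \<open>f_op\<close> count from 1.\<close>

definition fermi_exponent :: "('l \<Rightarrow> nat) \<Rightarrow> 'l list \<Rightarrow> 'l list \<Rightarrow> nat \<Rightarrow> nat" where
  "fermi_exponent par ns ms x = (par (ns ! x) + par (ms ! x)) * (\<Sum>y<x. par (ms ! y))"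

definition fermi_sign :: "('l \<Rightarrow> nat) \<Rightarrow> 'l list \<Rightarrow> 'l list \<Rightarrow> complex" where
  "fermi_sign par ns ms = (\<Prod>x<length ms. (- 1) ^ fermi_exponent par ns ms x)"

lemma f_op_carrier [simp]: "f_op d B par ket L x n m \<in> carrier_mat d d"
  by (simp add: f_op_def)

text \<open>The induction goes down from \<open>k = L\<close>, in the order in which the factors
  act: the sites beyond \<open>k\<close> have already been overwritten by \<open>ns\<close>, while
  the first \<open>k\<close> are untouched and supply the sign of the next factor.\<close>

lemma f_op_prod_ket:
  assumes kets: "kets d (configs B L) ket" and B: "finite B"
    and ns: "ns \<in> configs B L" and ms: "ms \<in> configs B L" and qs: "qs \<in> configs B L"
    and k: "k \<le> L"
  shows "mat_prod d (map (\<lambda>x. f_op d B par ket L x (ns ! (x - 1)) (ms ! (x - 1))) [k + 1..<L + 1])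
      *\<^sub>v ket qs =
    (if drop k qs = drop k ms
     then (\<Prod>x=k..<L. (- 1) ^ fermi_exponent par ns qs x) \<cdot>\<^sub>v ket (take k qs @ drop k ns)
     else 0\<^sub>v d)"
  using k
proof (induction k rule: inc_induct)
  case base
  have "ket qs \<in> carrier_vec d" using kets qs by (simp add: kets_def)
  then show ?case using configs_length[OF ns] configs_length[OF ms] configs_length[OF qs] by simp
next
  case (step k)
  let ?f = "\<lambda>x. f_op d B par ket L x (ns ! (x - 1)) (ms ! (x - 1))"
  let ?P = "mat_prod d (map ?f [Suc k + 1..<L + 1])"
  let ?c = "\<Prod>x=Suc k..<L. (- 1) ^ fermi_exponent par ns qs x :: complex"
  let ?q = "take (Suc k) qs @ drop (Suc k) ns"
  note len = configs_length[OF ns] configs_length[OF ms] configs_length[OF qs]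
  have P: "?P \<in> carrier_mat d d" by (rule mat_prod_carrier) auto
  have kq: "ket qs \<in> carrier_vec d" using kets qs by (simp add: kets_def)
  have q: "?q \<in> configs B L"
    using ns qs step(2) set_take_subset[of "Suc k" qs] set_drop_subset[of "Suc k" ns]
    by (fastforce simp: configs_def)
  then have kq': "ket ?q \<in> carrier_vec d" using kets by (simp add: kets_def)
  have drop_eq: "drop k qs = drop k ms \<longleftrightarrow> qs ! k = ms ! k \<and> drop (Suc k) qs = drop (Suc k) ms"
    using step(2) len by (simp flip: Cons_nth_drop_Suc)
  have upt: "[k + 1..<L + 1] = Suc k # [Suc k + 1..<L + 1]"
    using step(2) by (simp add: upt_conv_Cons)
  have "mat_prod d (map ?f [k + 1..<L + 1]) *\<^sub>v ket qs = ?f (Suc k) *\<^sub>v (?P *\<^sub>v ket qs)"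
    unfolding upt using P kq by (simp add: assoc_mult_mat_vec[of _ d d _ d])
  also have "\<dots> = (if drop k qs = drop k ms
     then (\<Prod>x=k..<L. (- 1) ^ fermi_exponent par ns qs x) \<cdot>\<^sub>v ket (take k qs @ drop k ns)
     else 0\<^sub>v d)"
  proof (cases "drop (Suc k) qs = drop (Suc k) ms")
    case False
    then show ?thesis using step drop_eq by (auto intro!: eq_vecI simp: f_op_def)
  next
    case True
    \<comment> \<open>The factor at site \<open>Suc k\<close> inspects only positions up to
      \<open>k\<close>, where the partly rewritten configuration is still the original one.\<close>
    have nth: "?q ! y = qs ! y" if "y \<le> k" for y
      using that step(2) len by (simp add: nth_append)
    have upd: "?q[k := ns ! k] = take k qs @ drop k ns"
      using step(2) len
      by (intro nth_equalityI) (auto simp: nth_append nth_list_update min_def)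
    have "(\<Sum>y=1..<Suc k. par (?q ! (y - 1))) = (\<Sum>y<k. par (qs ! y))"
      by (rule sum.reindex_bij_witness[of _ Suc "\<lambda>y. y - 1"]) (use nth in auto)
    then have "?f (Suc k) *\<^sub>v ket ?q = (if qs ! k = ms ! k
        then (- 1) ^ fermi_exponent par ns qs k \<cdot>\<^sub>v ket (take k qs @ drop k ns) else 0\<^sub>v d)"
      using f_op_ket[OF B, of "Suc k" L "ns ! k" ?q ket d par "ms ! k"] kets q
        configs_nth[OF ns] step(2) nth[of k] upd
      by (auto simp: kets_def fermi_exponent_def)
    moreover have "?f (Suc k) *\<^sub>v (?P *\<^sub>v ket qs) = ?c \<cdot>\<^sub>v (?f (Suc k) *\<^sub>v ket ?q)"
      using step.IH True kq' mult_mat_vec[OF f_op_carrier kq'] by simp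
    moreover have "(\<Prod>x=k..<L. (- 1) ^ fermi_exponent par ns qs x :: complex) =
        (- 1) ^ fermi_exponent par ns qs k * ?c"
      using step(2) by (simp add: prod.atLeast_Suc_lessThan)
    moreover have "?c \<cdot>\<^sub>v 0\<^sub>v d = 0\<^sub>v d" by auto
    ultimately show ?thesis using True drop_eq by (simp add: smult_smult_assoc mult.commute)
  qed
  finally show ?case .
qed

lemma mat_elem_smult:
  assumes "A \<in> carrier_mat d d" "v \<in> carrier_vec d" "w \<in> carrier_vec d"
  shows "mat_elem (c \<cdot>\<^sub>m A) v w = c * mat_elem A v w"
proof -
  have "c \<cdot>\<^sub>m A \<in> carrier_mat d d" using assms by simp
  then show ?thesis using assms by (simp add: mat_elem_sum[of _ d] sum_distrib_left mult_ac)
qed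

lemma f_sum_carrier [simp]: "f_sum d B par ket L c \<in> carrier_mat d d"
  by (simp add: f_sum_def mat_Sum_def)

text \<open>On the kets, the product of local operators labelled by a pair acts as the matrix unit
  of that pair up to sign, so a single summand survives. Every later statement about operators
  passes through this formula.\<close>

lemma mat_elem_f_sum:
  assumes kets: "kets d (configs B L) ket" and B: "finite B"
    and ns: "ns \<in> configs B L" and ms: "ms \<in> configs B L"
  shows "mat_elem (f_sum d B par ket L c) (ket ns) (ket ms) = c ns ms * fermi_sign par ns ms"
proof -
  let ?C = "configs B L"
  let ?F = "\<lambda>(ns, ms). mat_prod d (map (\<lambda>x. f_op d B par ket L x (ns ! (x - 1)) (ms ! (x - 1))) [1..<L + 1])"
  have F: "?F s \<in> carrier_mat d d" for s
    by (cases s) (auto intro!: mat_prod_carrier)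
  have kn: "ket ns \<in> carrier_vec d" and km: "ket ms \<in> carrier_vec d"
    using kets ns ms by (auto simp: kets_def)
  have fin: "finite ?C" by (rule finite_configs[OF B])
  have elem: "mat_elem (?F s) (ket ns) (ket ms) = (if s = (ns, ms) then fermi_sign par ns ms else 0)"
    if s: "s \<in> ?C \<times> ?C" for s
  proof -
    obtain ns' ms' where s': "s = (ns', ms')" "ns' \<in> ?C" "ms' \<in> ?C" using s by auto
    have kn': "ket ns' \<in> carrier_vec d" using kets s' by (simp add: kets_def)
    have "ket ns' \<bullet>c ket ns = (if ns' = ns then 1 else 0)"
      using kets s' ns by (simp add: kets_def)
    moreover have "?F s *\<^sub>v ket ms =
        (if ms = ms' then fermi_sign par ns' ms \<cdot>\<^sub>v ket ns' else 0\<^sub>v d)"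
      using f_op_prod_ket[OF kets B s'(2,3) ms, of 0 par] s' configs_length[OF ms]
        configs_length[OF s'(3)]
      by (simp add: fermi_sign_def lessThan_atLeast0)
    ultimately show ?thesis
      using kn kn' s' by (auto simp: mat_elem_def)
  qed
  have "mat_elem (f_sum d B par ket L c) (ket ns) (ket ms) =
      (\<Sum>s\<in>?C \<times> ?C. mat_elem (case s of (ns, ms) \<Rightarrow> c ns ms \<cdot>\<^sub>m ?F (ns, ms)) (ket ns) (ket ms))"
    unfolding f_sum_def using F
    by (subst mat_elem_mat_Sum[OF kn km]) (auto split: prod.splits)
  also have "\<dots> = (\<Sum>s\<in>?C \<times> ?C. if s = (ns, ms) then c ns ms * fermi_sign par ns ms else 0)"
  proof (rule sum.cong)
    fix s assume s: "s \<in> ?C \<times> ?C"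
    obtain ns' ms' where s': "s = (ns', ms')" by (cases s)
    show "mat_elem (case s of (ns, ms) \<Rightarrow> c ns ms \<cdot>\<^sub>m ?F (ns, ms)) (ket ns) (ket ms) =
       (if s = (ns, ms) then c ns ms * fermi_sign par ns ms else 0)"
      using elem[OF s] mat_elem_smult[OF F[of s] kn km] s' by auto
  qed simp
  also have "\<dots> = c ns ms * fermi_sign par ns ms"
    using fin ns ms by simp
  finally show ?thesis .
qed

section \<open>Obstructions to being a plain fMPO\<close>

text \<open>\<open>Z\<close> is moved through the product one factor at a time and the signs
  multiply. The carrier claim is part of the induction because each commutation needs the dimensions
  of the remaining product.\<close>

lemma even_tensor_prod:
  assumes U: "even_tensor B par D Z U" and ns: "set ns \<subseteq> B" and ms: "set ms \<subseteq> B"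
    and len: "length ns = length ms"
  shows "mat_prod D (map2 U ns ms) \<in> carrier_mat D D \<and>
    Z * mat_prod D (map2 U ns ms) =
      (- 1) ^ (sum_list (map par ns) + sum_list (map par ms)) \<cdot>\<^sub>m (mat_prod D (map2 U ns ms) * Z)"
  using len ns ms
proof (induction ns ms rule: list_induct2)
  case Nil
  then show ?case using U by (auto simp: even_tensor_def)
next
  case (Cons n ns m ms)
  let ?P = "mat_prod D (map2 U ns ms)"
  let ?s = "\<lambda>n m. (- 1) ^ (par n + par m) :: complex"
  let ?t = "(- 1) ^ (sum_list (map par ns) + sum_list (map par ms)) :: complex"
  have Z: "Z \<in> carrier_mat D D" and V: "U n m \<in> carrier_mat D D"
    and ZU: "Z * U n m = ?s n m \<cdot>\<^sub>m (U n m * Z)"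
    using U Cons.prems by (auto simp: even_tensor_def)
  have P: "?P \<in> carrier_mat D D" and ZP: "Z * ?P = ?t \<cdot>\<^sub>m (?P * Z)" using Cons by auto
  have "Z * (U n m * ?P) = ?s n m \<cdot>\<^sub>m (U n m * Z) * ?P"
    using Z V P ZU assoc_mult_mat[OF Z V P] by simp
  also have "\<dots> = ?s n m \<cdot>\<^sub>m (U n m * (Z * ?P))"
    using Z V P mult_smult_assoc_mat[of "U n m * Z" D D ?P D] assoc_mult_mat[OF V Z P] by simp
  also have "\<dots> = (?s n m * ?t) \<cdot>\<^sub>m (U n m * (?P * Z))"
    unfolding ZP using Z V P mult_smult_distrib[OF V, of "?P * Z" D ?t]
    by (auto simp: mult.assoc)
  also have "U n m * (?P * Z) = U n m * ?P * Z"
    using assoc_mult_mat[OF V P Z] by simp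
  finally show ?case using V P by (simp add: power_add mult_ac)
qed

text \<open>Anticommutation and cyclicity of the trace give
  \<open>tr (Z P) = - tr (P Z) = - tr (Z P)\<close>.\<close>

lemma mtrace_odd_zero:
  assumes U: "even_tensor B par D Z U" and ns: "set ns \<subseteq> B" and ms: "set ms \<subseteq> B"
    and len: "length ns = length ms"
    and odd: "odd (sum_list (map par ns) + sum_list (map par ms))"
  shows "mtrace (Z * mat_prod D (map2 U ns ms)) = 0"
proof -
  let ?P = "mat_prod D (map2 U ns ms)"
  have Z: "Z \<in> carrier_mat D D" using U by (simp add: even_tensor_def)
  have P: "?P \<in> carrier_mat D D" and ZP: "Z * ?P = - 1 \<cdot>\<^sub>m (?P * Z)"
    using even_tensor_prod[OF U ns ms len] odd by (auto simp: uminus_power_if)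
  have "mtrace (Z * ?P) = - mtrace (?P * Z)"
    unfolding ZP using mtrace_smult[of "?P * Z" D "- 1"] Z P by simp
  also have "\<dots> = - mtrace (Z * ?P)"
    using mtrace_comm[OF P Z] by simp
  finally show ?thesis by simp
qed

lemma not_plain_periodic_if_odd_elem:
  assumes kets: "kets d (configs B L) ket" and B: "finite B"
    and ns: "ns \<in> configs B L" and ms: "ms \<in> configs B L"
    and odd: "odd (sum_list (map par ns) + sum_list (map par ms))"
    and nz: "mat_elem A (ket ns) (ket ms) \<noteq> 0"
  shows "\<not> (\<exists>D Z U. even_tensor B par D Z U \<and> A = plain_periodic_fMPO d B par ket L D Z U)"
proof clarify
  fix D Z U assume U: "even_tensor B par D Z U" and A: "A = plain_periodic_fMPO d B par ket L D Z U"
  have "mtrace (Z * mat_prod D (map2 U ns ms)) = 0"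
    using ns ms by (intro mtrace_odd_zero[OF U _ _ _ odd]) (auto simp: configs_def)
  then have "mat_elem A (ket ns) (ket ms) = 0"
    by (simp add: A plain_periodic_fMPO_def mat_elem_f_sum[OF kets B ns ms])
  with nz show False by simp
qed

text \<open>At a constant configuration of an even label \<open>b\<close> the fermionic sign is 1,
  so the diagonal entry is the trace of the \<open>L\<close>-th power of the fixed matrix
  \<open>U b b\<close>. The label and \<open>r\<close> stay general so that single sites and blocks
  are both covered.\<close>

lemma not_plain_antiperiodic_if_sqrt_2:
  assumes kets: "\<And>L. L \<ge> 1 \<Longrightarrow> kets (d L) (configs B L) (ket L)" and B: "finite B"
    and b: "b \<in> B" "par b = 0" and r: "r \<noteq> 0"
    and elem: "\<And>L. L \<ge> 1 \<Longrightarrow> mat_elem (A L) (ket L (replicate L b)) (ket L (replicate L b)) =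
      complex_of_real (sqrt 2) * r ^ L"
  shows "\<not> (\<exists>D Z U. even_tensor B par D Z U \<and>
    (\<forall>L\<ge>1. A L = plain_antiperiodic_fMPO (d L) B par (ket L) L D U))"
proof clarify
  fix D Z U assume U: "even_tensor B par D Z U"
    and A: "\<forall>L\<ge>1. A L = plain_antiperiodic_fMPO (d L) B par (ket L) L D U"
  have Ub: "U b b \<in> carrier_mat D D" using U b by (simp add: even_tensor_def)
  have "mtrace (U b b ^\<^sub>m L) = complex_of_real (sqrt 2) * r ^ L" if L: "L \<ge> 1" for L
  proof -
    have c: "replicate L b \<in> configs B L" using b by (auto simp: configs_def)
    have "fermi_sign par (replicate L b) (replicate L b) = 1"
      using b by (simp add: fermi_sign_def fermi_exponent_def)
    then have "mtrace (U b b ^\<^sub>m L) = mat_elem (A L) (ket L (replicate L b)) (ket L (replicate L b))"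
      using A L
      by (simp add: plain_antiperiodic_fMPO_def mat_elem_f_sum[OF kets[OF L] B c c] zip_replicate
          mat_prod_replicate[OF Ub])
    then show ?thesis using elem[OF L] by simp
  qed
  with mtrace_pow_neq_sqrt_2[OF Ub r] show False by blast
qed

subsection \<open>The Fock basis\<close>

lemma cscalar_prod_adjoint':
  fixes A :: "complex mat"
  assumes "A \<in> carrier_mat d d" "v \<in> carrier_vec d" "w \<in> carrier_vec d"
  shows "v \<bullet>c (mat_adjoint A *\<^sub>v w) = (A *\<^sub>v v) \<bullet>c w"
proof -
  have "v \<bullet>c (mat_adjoint A *\<^sub>v w) = cnj ((mat_adjoint A *\<^sub>v w) \<bullet>c v)"
    using assms by (auto simp: scalar_prod_def mult.commute)
  also have "\<dots> = cnj (w \<bullet>c (A *\<^sub>v v))"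
    by (simp add: cscalar_prod_adjoint[OF assms])
  also have "\<dots> = (A *\<^sub>v v) \<bullet>c w"
    using assms by (auto simp: scalar_prod_def mult.commute)
  finally show ?thesis .
qed

lemma mat_adjoint_mult:
  fixes A B :: "complex mat"
  assumes "A \<in> carrier_mat n m" "B \<in> carrier_mat m k"
  shows "mat_adjoint (A * B) = mat_adjoint B * mat_adjoint A"
  by (rule eq_matI)
    (use assms in \<open>auto simp: mat_adjoint_index scalar_prod_def mult.commute intro!: sum.cong\<close>)

lemma mat_adjoint_add:
  fixes A B :: "complex mat"
  assumes "A \<in> carrier_mat n m" "B \<in> carrier_mat n m"
  shows "mat_adjoint (A + B) = mat_adjoint A + mat_adjoint B"
  by (rule eq_matI) (use assms in \<open>auto simp: mat_adjoint_index\<close>)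

lemma mat_adjoint_zero: "mat_adjoint (0\<^sub>m n m :: complex mat) = 0\<^sub>m m n"
  by (rule eq_matI) (auto simp: mat_adjoint_index)

lemma mat_mult_zero_vec:
  fixes A :: "'a :: semiring_1 mat"
  shows "A \<in> carrier_mat n m \<Longrightarrow> A *\<^sub>v 0\<^sub>v m = 0\<^sub>v n"
  by (intro eq_vecI) auto

lemma anticomm_vec:
  fixes A B :: "complex mat"
  assumes AB: "A * B + B * A = 0\<^sub>m n n" and A: "A \<in> carrier_mat n n" and B: "B \<in> carrier_mat n n"
    and v: "v \<in> carrier_vec n"
  shows "A *\<^sub>v (B *\<^sub>v v) = - (B *\<^sub>v (A *\<^sub>v v))"
proof -
  have "(A * B + B * A) *\<^sub>v v = A *\<^sub>v (B *\<^sub>v v) + B *\<^sub>v (A *\<^sub>v v)"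
    using A B v by (simp add: add_mult_distrib_mat_vec[of _ n n])
  moreover have zero: "0\<^sub>m n n *\<^sub>v v = 0\<^sub>v n"
    using v by (intro eq_vecI) auto
  ultimately have sum: "A *\<^sub>v (B *\<^sub>v v) + B *\<^sub>v (A *\<^sub>v v) = 0\<^sub>v n"
    using AB v by (simp add: zero)
  show ?thesis
  proof (rule eq_vecI)
    fix i assume "i < dim_vec (- (B *\<^sub>v (A *\<^sub>v v)))"
    then have i: "i < n" using B by simp
    have "(A *\<^sub>v (B *\<^sub>v v) + B *\<^sub>v (A *\<^sub>v v)) $ i = 0" using sum i by simp
    then show "(A *\<^sub>v (B *\<^sub>v v)) $ i = (- (B *\<^sub>v (A *\<^sub>v v))) $ i"
      using A B i by (simp add: add_eq_0_iff2 del: index_mult_mat_vec)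
  qed (use A B in auto)
qed

text \<open>The two combinations are the shapes of the Majorana operators with odd and with even
  index.\<close>

lemma lin_comb_anticomm:
  fixes X Y Z :: "complex mat"
  assumes X: "X \<in> carrier_mat n n" and Y: "Y \<in> carrier_mat n n" and Z: "Z \<in> carrier_mat n n"
    and "X * Z + Z * X = 0\<^sub>m n n" "Y * Z + Z * Y = 0\<^sub>m n n"
  shows "(X + Y) * Z + Z * (X + Y) = 0\<^sub>m n n"
    and "(c \<cdot>\<^sub>m (X - Y)) * Z + Z * (c \<cdot>\<^sub>m (X - Y)) = 0\<^sub>m n n"
proof -
  have xz: "row X i \<bullet> col Z j = - (row Z i \<bullet> col X j)" if "i < n" "j < n" for i j
    using arg_cong[OF assms(4), of "\<lambda>M. M $$ (i, j)"] X Y Z that by (simp add: eq_neg_iff_add_eq_0)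
  have yz: "row Y i \<bullet> col Z j = - (row Z i \<bullet> col Y j)" if "i < n" "j < n" for i j
    using arg_cong[OF assms(5), of "\<lambda>M. M $$ (i, j)"] X Y Z that by (simp add: eq_neg_iff_add_eq_0)
  show "(X + Y) * Z + Z * (X + Y) = 0\<^sub>m n n"
    using X Y Z by (intro eq_matI)
      (auto simp: add_mult_distrib_mat[of _ n n] mult_add_distrib_mat[of _ n n] xz yz)
  have l: "(c \<cdot>\<^sub>m (X - Y)) * Z = c \<cdot>\<^sub>m (X * Z - Y * Z)"
    using mult_smult_assoc_mat[OF minus_carrier_mat[OF Y] Z] minus_mult_distrib_mat[OF X Y Z] by simp
  have r: "Z * (c \<cdot>\<^sub>m (X - Y)) = c \<cdot>\<^sub>m (Z * X - Z * Y)"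
    using mult_smult_distrib[OF Z minus_carrier_mat[OF Y]] mult_minus_distrib_mat[OF Z X Y] by simp
  show "(c \<cdot>\<^sub>m (X - Y)) * Z + Z * (c \<cdot>\<^sub>m (X - Y)) = 0\<^sub>m n n"
    unfolding l r using X Y Z by (intro eq_matI) (auto simp: xz yz algebra_simps)
qed

text \<open>With positions counted from 0, \<open>occ x\<close> is the Jordan-Wigner exponent of
  site \<open>x + 1\<close>: the particle number strictly to its left.\<close>

definition occ :: "nat \<Rightarrow> nat list \<Rightarrow> nat" where
  "occ k p = (\<Sum>y<k. p ! y)"

definition flip :: "nat \<Rightarrow> nat list \<Rightarrow> nat list" where
  "flip x p = p[x := 1 - p ! x]"

lemma flip_configs: "p \<in> configs site_labels N \<Longrightarrow> flip x p \<in> configs site_labels N"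
  unfolding flip_def by (rule configs_update) auto

locale fock_space =
  fixes N :: nat and a :: "nat \<Rightarrow> complex mat" and \<Omega> :: "complex vec"
  assumes modes: "fermion_modes N a \<Omega>"
begin

abbreviation "d \<equiv> (2 :: nat) ^ N"
abbreviation "C \<equiv> configs site_labels N"
abbreviation "ad x \<equiv> mat_adjoint (a x)"

lemma a_carrier: "x \<in> {1..N} \<Longrightarrow> a x \<in> carrier_mat d d"
  using modes by (simp add: fermion_modes_def)

lemma ad_carrier: "x \<in> {1..N} \<Longrightarrow> ad x \<in> carrier_mat d d"
  using a_carrier by simp

lemma vac: "\<Omega> \<in> carrier_vec d" "\<Omega> \<bullet>c \<Omega> = 1" "x \<in> {1..N} \<Longrightarrow> a x *\<^sub>v \<Omega> = 0\<^sub>v d"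
  using modes by (auto simp: fermion_modes_def)

lemma a_ad:
  assumes "x \<in> {1..N}" "y \<in> {1..N}" "x \<noteq> y"
  shows "a x * ad y + ad y * a x = 0\<^sub>m d d"
  using modes assms by (simp add: fermion_modes_def)

lemma ad_ad:
  assumes x: "x \<in> {1..N}" and y: "y \<in> {1..N}"
  shows "ad x * ad y + ad y * ad x = 0\<^sub>m d d"
proof -
  have "a y * a x + a x * a y = 0\<^sub>m d d"
    using modes x y by (simp add: fermion_modes_def)
  then have "mat_adjoint (a y * a x + a x * a y) = mat_adjoint (0\<^sub>m d d)"
    by (rule arg_cong)
  then show ?thesis
    using a_carrier[OF x] a_carrier[OF y]
    by (simp add: mat_adjoint_add[of _ d d] mat_adjoint_mult[of _ d d] mat_adjoint_zero)
qed

text \<open>The anticommutation relation at equal sites makes this vector equal to its own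
  negative.\<close>

lemma ad_square_vec:
  assumes x: "x \<in> {1..N}" and v: "v \<in> carrier_vec d"
  shows "ad x *\<^sub>v (ad x *\<^sub>v v) = 0\<^sub>v d"
proof (rule eq_vecI)
  have eq: "ad x *\<^sub>v (ad x *\<^sub>v v) = - (ad x *\<^sub>v (ad x *\<^sub>v v))"
    by (rule anticomm_vec[OF ad_ad[OF x x] ad_carrier[OF x] ad_carrier[OF x] v])
  fix i assume "i < dim_vec (0\<^sub>v d :: complex vec)"
  then have i: "i < d" by simp
  have "(ad x *\<^sub>v (ad x *\<^sub>v v)) $ i = - ((ad x *\<^sub>v (ad x *\<^sub>v v)) $ i)"
    using arg_cong[OF eq, of "\<lambda>u. u $ i"] i a_carrier[OF x] by (simp del: index_mult_mat_vec)
  then show "(ad x *\<^sub>v (ad x *\<^sub>v v)) $ i = 0\<^sub>v d $ i" using i by (simp del: index_mult_mat_vec)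
qed (use a_carrier[OF x] in simp)

lemma a_ad_vec:
  assumes x: "x \<in> {1..N}" and v: "v \<in> carrier_vec d" and av: "a x *\<^sub>v v = 0\<^sub>v d"
  shows "a x *\<^sub>v (ad x *\<^sub>v v) = v"
proof -
  note A = a_carrier[OF x] and B = ad_carrier[OF x]
  have "(a x * ad x + ad x * a x) *\<^sub>v v = a x *\<^sub>v (ad x *\<^sub>v v) + ad x *\<^sub>v (a x *\<^sub>v v)"
    using add_mult_distrib_mat_vec[OF mult_carrier_mat[OF A B] mult_carrier_mat[OF B A] v]
      assoc_mult_mat_vec[OF A B v] assoc_mult_mat_vec[OF B A v] by simp
  moreover have "a x * ad x + ad x * a x = 1\<^sub>m d"
    using modes x by (simp add: fermion_modes_def)
  moreover have "ad x *\<^sub>v 0\<^sub>v d = 0\<^sub>v d"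
    using mat_mult_zero_vec[OF B] .
  ultimately show ?thesis
    using av v right_zero_vec[OF mult_mat_vec_carrier[OF A mult_mat_vec_carrier[OF B v]]] by simp
qed

text \<open>Only the creation operators of the sites \<open>i, ..., N\<close> are applied. This
  allows induction downwards from the vacuum at \<open>i = N + 1\<close> to the full Fock ket at
  \<open>i = 1\<close>.\<close>

definition tail_ket :: "nat \<Rightarrow> nat list \<Rightarrow> complex vec" where
  "tail_ket i p = mat_prod d (map (\<lambda>x. ad x ^\<^sub>m (p ! (x - 1))) [i..<N + 1]) *\<^sub>v \<Omega>"

lemma fock_ket_tail: "fock_ket N a \<Omega> p = tail_ket 1 p"
  by (simp add: fock_ket_def tail_ket_def)

lemma tail_ket_end: "tail_ket (Suc N) p = \<Omega>"
  using vac(1) by (simp add: tail_ket_def)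

lemma tail_prod_carrier:
  "1 \<le> i \<Longrightarrow> mat_prod d (map (\<lambda>x. ad x ^\<^sub>m (p ! (x - 1))) [i..<N + 1]) \<in> carrier_mat d d"
  by (rule mat_prod_carrier) (auto intro!: pow_carrier_mat ad_carrier)

lemma tail_ket_carrier: "1 \<le> i \<Longrightarrow> tail_ket i p \<in> carrier_vec d"
  unfolding tail_ket_def by (rule mult_mat_vec_carrier[OF tail_prod_carrier vac(1)])

lemma tail_ket_step:
  assumes i: "i \<in> {1..N}" and p: "p \<in> C"
  shows "tail_ket i p = (if p ! (i - 1) = 0 then tail_ket (Suc i) p else ad i *\<^sub>v tail_ket (Suc i) p)"
proof -
  have upt: "[i..<N + 1] = i # [Suc i..<N + 1]" using i by (simp add: upt_conv_Cons)
  have "p ! (i - 1) \<in> site_labels" using i by (intro configs_nth[OF p]) auto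
  then have pw: "ad i ^\<^sub>m (p ! (i - 1)) = (if p ! (i - 1) = 0 then 1\<^sub>m d else ad i)"
    using ad_carrier[OF i] a_carrier[OF i] by auto
  have eq: "tail_ket i p = ad i ^\<^sub>m (p ! (i - 1)) *\<^sub>v tail_ket (Suc i) p"
    unfolding tail_ket_def upt
    using assoc_mult_mat_vec[OF pow_carrier_mat[OF ad_carrier[OF i]] tail_prod_carrier[of "Suc i" p] vac(1)]
    by (simp del: upt_Suc)
  show ?thesis unfolding eq pw using tail_ket_carrier[of "Suc i" p] by auto
qed

text \<open>A site left of the tail differs from every site in it, so \<open>a x\<close>
  anticommutes past all the creation operators and reaches the vacuum.\<close>

lemma a_tail_ket:
  assumes p: "p \<in> C" and x: "x \<in> {1..N}" and i: "x < i" "i \<le> Suc N"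
  shows "a x *\<^sub>v tail_ket i p = 0\<^sub>v d"
  using i(2,1)
proof (induction i rule: inc_induct)
  case base
  show ?case using vac x by (simp add: tail_ket_end)
next
  case (step i)
  then have i: "i \<in> {1..N}" and IH: "a x *\<^sub>v tail_ket (Suc i) p = 0\<^sub>v d" using x by auto
  have t: "tail_ket (Suc i) p \<in> carrier_vec d" by (rule tail_ket_carrier) simp
  have "a x *\<^sub>v (ad i *\<^sub>v tail_ket (Suc i) p) = - (ad i *\<^sub>v (a x *\<^sub>v tail_ket (Suc i) p))"
    using a_ad[OF x i] step a_carrier[OF x] ad_carrier[OF i] t by (intro anticomm_vec) auto
  also have "\<dots> = 0\<^sub>v d" unfolding IH mat_mult_zero_vec[OF ad_carrier[OF i]] by auto
  finally show ?case using IH by (simp add: tail_ket_step[OF i p])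
qed

text \<open>Site \<open>i\<close> is stripped off both kets. If it is occupied in both,
  \<open>a i\<close> cancels \<open>ad i\<close>; if in only one, the adjoint moves
  \<open>a i\<close> onto a tail that it annihilates.\<close>

lemma tail_ket_inner:
  assumes p: "p \<in> C" and q: "q \<in> C" and i: "1 \<le> i" "i \<le> Suc N"
  shows "tail_ket i p \<bullet>c tail_ket i q = (if drop (i - 1) p = drop (i - 1) q then 1 else 0)"
  using i(2,1)
proof (induction i rule: inc_induct)
  case base
  show ?case using vac configs_length[OF p] configs_length[OF q] by (simp add: tail_ket_end)
next
  case (step i)
  then have i: "i \<in> {1..N}"
    and IH: "tail_ket (Suc i) p \<bullet>c tail_ket (Suc i) q = (if drop i p = drop i q then 1 else 0)"
    by auto
  let ?t = "tail_ket (Suc i) p" and ?u = "tail_ket (Suc i) q"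
  note A = a_carrier[OF i]
  have t: "?t \<in> carrier_vec d" and u: "?u \<in> carrier_vec d" by (simp_all add: tail_ket_carrier)
  have at: "a i *\<^sub>v ?t = 0\<^sub>v d" and au: "a i *\<^sub>v ?u = 0\<^sub>v d"
    using a_tail_ket[OF _ i] p q i by auto
  have adt: "ad i *\<^sub>v ?u \<in> carrier_vec d" using ad_carrier[OF i] u by simp
  have "(ad i *\<^sub>v ?t) \<bullet>c (ad i *\<^sub>v ?u) = ?t \<bullet>c (a i *\<^sub>v (ad i *\<^sub>v ?u))"
    by (rule cscalar_prod_adjoint[OF A adt t])
  then have 11: "(ad i *\<^sub>v ?t) \<bullet>c (ad i *\<^sub>v ?u) = ?t \<bullet>c ?u"
    using a_ad_vec[OF i u au] by simp
  have 10: "(ad i *\<^sub>v ?t) \<bullet>c ?u = 0"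
    using cscalar_prod_adjoint[OF A u t] au t by simp
  have 01: "?t \<bullet>c (ad i *\<^sub>v ?u) = 0"
    using cscalar_prod_adjoint'[OF A t u] at u by simp
  have "drop (i - 1) p = drop (i - 1) q \<longleftrightarrow> p ! (i - 1) = q ! (i - 1) \<and> drop i p = drop i q"
    using i configs_length[OF p] configs_length[OF q]
      Cons_nth_drop_Suc[of "i - 1" p] Cons_nth_drop_Suc[of "i - 1" q] by (auto simp flip: Cons_nth_drop_Suc)
  moreover have "p ! (i - 1) \<in> site_labels" "q ! (i - 1) \<in> site_labels"
    using configs_nth[OF p, of "i - 1"] configs_nth[OF q, of "i - 1"] i by auto
  ultimately show ?case
    using IH 11 10 01 by (auto simp: tail_ket_step[OF i p] tail_ket_step[OF i q])
qed

text \<open>Orthonormal kets form a basis because there are exactly \<open>2 ^ N\<close>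
  configurations, the dimension demanded by \<open>fermion_modes\<close>.\<close>

lemma ket_basis: "ket_basis d C (fock_ket N a \<Omega>)"
proof
  fix p q assume "p \<in> C" "q \<in> C"
  then show "fock_ket N a \<Omega> p \<bullet>c fock_ket N a \<Omega> q = (if p = q then 1 else 0)"
    using tail_ket_inner[of p q 1] by (simp add: fock_ket_tail)
qed (auto simp: fock_ket_tail tail_ket_carrier finite_configs card_configs simp flip: numeral_2_eq_2)

lemma tail_ket_cong:
  assumes i: "1 \<le> i" and pq: "\<And>y. i \<le> y \<Longrightarrow> y \<le> N \<Longrightarrow> p ! (y - 1) = q ! (y - 1)"
  shows "tail_ket i p = tail_ket i q"
proof -
  have "map (\<lambda>x. ad x ^\<^sub>m (p ! (x - 1))) [i..<N + 1] = map (\<lambda>x. ad x ^\<^sub>m (q ! (x - 1))) [i..<N + 1]"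
    using pq by (auto simp del: upt_Suc)
  then show ?thesis by (simp only: tail_ket_def)
qed

text \<open>This produces the Jordan-Wigner string: an operator whose action is known from site
  \<open>x\<close> on is moved past the creation operators to the left of \<open>x\<close>, gaining
  \<open>- 1\<close> at each occupied site.\<close>

lemma anticomm_tail_ket:
  assumes B: "B \<in> carrier_mat d d" and p: "p \<in> C" and q: "q \<in> C"
    and x: "x \<in> {1..N}"
    and anti: "\<And>y. y \<in> {1..N} \<Longrightarrow> y < x \<Longrightarrow> B * ad y + ad y * B = 0\<^sub>m d d"
    and pq: "\<And>y. y < x - 1 \<Longrightarrow> p ! y = q ! y"
    and Bx: "B *\<^sub>v tail_ket x p = c \<cdot>\<^sub>v tail_ket x q"
    and i: "1 \<le> i" "i \<le> x"
  shows "B *\<^sub>v tail_ket i p = ((- 1) ^ (\<Sum>y=i..<x. p ! (y - 1)) * c) \<cdot>\<^sub>v tail_ket i q"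
  using i(2,1)
proof (induction i rule: inc_induct)
  case base
  show ?case using Bx by simp
next
  case (step i)
  then have i: "i \<in> {1..N}" using x by auto
  let ?t = "tail_ket (Suc i) p" and ?u = "tail_ket (Suc i) q"
  have t: "?t \<in> carrier_vec d" and u: "?u \<in> carrier_vec d" by (simp_all add: tail_ket_carrier)
  let ?s = "(- 1) ^ (\<Sum>y=Suc i..<x. p ! (y - 1)) * c"
  have IH: "B *\<^sub>v ?t = ?s \<cdot>\<^sub>v ?u" using step by simp
  have pi: "p ! (i - 1) = q ! (i - 1)" using pq[of "i - 1"] step by simp
  have sum: "(\<Sum>y=i..<x. p ! (y - 1)) = p ! (i - 1) + (\<Sum>y=Suc i..<x. p ! (y - 1))"
    using step by (simp add: sum.atLeast_Suc_lessThan)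
  show ?case
  proof (cases "p ! (i - 1) = 0")
    case True
    then show ?thesis using IH pi sum by (simp add: tail_ket_step[OF i p] tail_ket_step[OF i q])
  next
    case False
    then have one: "p ! (i - 1) = 1" using configs_nth[OF p, of "i - 1"] i by auto
    have "B *\<^sub>v (ad i *\<^sub>v ?t) = - (ad i *\<^sub>v (B *\<^sub>v ?t))"
      using anti[OF i] step B ad_carrier[OF i] t by (intro anticomm_vec) auto
    also have "\<dots> = - (?s \<cdot>\<^sub>v (ad i *\<^sub>v ?u))"
      unfolding IH using mult_mat_vec[OF ad_carrier[OF i] u] by simp
    also have "\<dots> = (- ?s) \<cdot>\<^sub>v (ad i *\<^sub>v ?u)"
      by auto
    finally show ?thesis using one pi sum
      by (simp add: tail_ket_step[OF i p] tail_ket_step[OF i q])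
  qed
qed

section \<open>Majorana operators in the Fock basis\<close>

lemma majorana_odd: "majorana a (2 * x + 1) = ad (Suc x) + a (Suc x)"
  by (simp add: majorana_def)

lemma majorana_even: "majorana a (2 * x + 2) = \<i> \<cdot>\<^sub>m (ad (Suc x) - a (Suc x))"
  by (simp add: majorana_def)

lemma majorana_carrier:
  assumes "x < N"
  shows "majorana a (2 * x + 1) \<in> carrier_mat d d" "majorana a (2 * x + 2) \<in> carrier_mat d d"
  using assms a_carrier[of "Suc x"] ad_carrier[of "Suc x"]
  unfolding majorana_odd majorana_even by auto

lemma flip_tail:
  assumes p: "p \<in> C" and x: "x < N"
  shows "tail_ket (Suc x) (flip x p) =
    (if p ! x = 0 then ad (Suc x) *\<^sub>v tail_ket (Suc (Suc x)) p else tail_ket (Suc (Suc x)) p)"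
proof -
  have "tail_ket (Suc (Suc x)) (flip x p) = tail_ket (Suc (Suc x)) p"
    by (rule tail_ket_cong) (auto simp: flip_def)
  moreover have "flip x p ! x = 1 - p ! x"
    using x configs_length[OF p] by (simp add: flip_def)
  ultimately show ?thesis
    using tail_ket_step[of "Suc x" "flip x p"] flip_configs[OF p] x configs_nth[OF p x] by auto
qed

lemma sum_occ: "(\<Sum>y=1..<Suc x. p ! (y - 1)) = occ x p"
  unfolding occ_def by (rule sum.reindex_bij_witness[of _ Suc "\<lambda>y. y - 1"]) auto

lemma majorana_tail_ket:
  assumes p: "p \<in> C" and x: "x < N"
  shows "majorana a (2 * x + 1) *\<^sub>v tail_ket (Suc x) p = 1 \<cdot>\<^sub>v tail_ket (Suc x) (flip x p)"
    and "majorana a (2 * x + 2) *\<^sub>v tail_ket (Suc x) p =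
      (\<i> * (- 1) ^ (p ! x)) \<cdot>\<^sub>v tail_ket (Suc x) (flip x p)"
proof -
  let ?t = "tail_ket (Suc (Suc x)) p"
  have X: "Suc x \<in> {1..N}" using x by simp
  note A = a_carrier[OF X] and AD = ad_carrier[OF X]
  have t: "?t \<in> carrier_vec d" by (rule tail_ket_carrier) simp
  have u: "tail_ket (Suc x) p \<in> carrier_vec d" by (rule tail_ket_carrier) simp
  have at: "a (Suc x) *\<^sub>v ?t = 0\<^sub>v d" using a_tail_ket[OF p X] x by auto
  note ada = a_ad_vec[OF X t at] ad_square_vec[OF X t]
  have p01: "p ! x = 0 \<or> p ! x = 1" using configs_nth[OF p x] by auto
  have step: "tail_ket (Suc x) p = (if p ! x = 0 then ?t else ad (Suc x) *\<^sub>v ?t)"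
    using tail_ket_step[OF X p] by simp
  have adt: "ad (Suc x) *\<^sub>v ?t \<in> carrier_vec d" using AD t by simp
  show "majorana a (2 * x + 1) *\<^sub>v tail_ket (Suc x) p = 1 \<cdot>\<^sub>v tail_ket (Suc x) (flip x p)"
    unfolding majorana_odd add_mult_distrib_mat_vec[OF AD A u]
    using p01 adt t by (auto simp: step flip_tail[OF p x] ada at)
  have "majorana a (2 * x + 2) *\<^sub>v tail_ket (Suc x) p =
      \<i> \<cdot>\<^sub>v (ad (Suc x) *\<^sub>v tail_ket (Suc x) p - a (Suc x) *\<^sub>v tail_ket (Suc x) p)"
    unfolding majorana_even minus_mult_distrib_mat_vec[OF AD A u, symmetric]
    using A u by (intro eq_vecI) auto
  then show "majorana a (2 * x + 2) *\<^sub>v tail_ket (Suc x) p =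
      (\<i> * (- 1) ^ (p ! x)) \<cdot>\<^sub>v tail_ket (Suc x) (flip x p)"
    using p01 adt t by (auto simp: step flip_tail[OF p x] ada at)
qed

text \<open>For the even index, the local phase \<open>(- 1) ^ (p ! x)\<close> is absorbed into the
  string, which then includes the flipped site; hence \<open>occ (Suc x)\<close> instead of
  \<open>occ x\<close>.\<close>

lemma majorana_fock_ket:
  assumes p: "p \<in> C" and x: "x < N"
  shows "majorana a (2 * x + 1) *\<^sub>v fock_ket N a \<Omega> p =
      (- 1) ^ occ x p \<cdot>\<^sub>v fock_ket N a \<Omega> (flip x p)"
    and "majorana a (2 * x + 2) *\<^sub>v fock_ket N a \<Omega> p =
      (\<i> * (- 1) ^ occ (Suc x) p) \<cdot>\<^sub>v fock_ket N a \<Omega> (flip x p)"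
proof -
  have X: "Suc x \<in> {1..N}" using x by simp
  have anti: "majorana a (2 * x + 1) * ad y + ad y * majorana a (2 * x + 1) = 0\<^sub>m d d"
      "majorana a (2 * x + 2) * ad y + ad y * majorana a (2 * x + 2) = 0\<^sub>m d d"
    if y: "y \<in> {1..N}" "y < Suc x" for y
    unfolding majorana_odd majorana_even
    using lin_comb_anticomm[OF ad_carrier[OF X] a_carrier[OF X] ad_carrier[OF y(1)]
        ad_ad[OF X y(1)] a_ad[OF X y(1)]] y by auto
  have agree: "p ! y = flip x p ! y" if "y < Suc x - 1" for y using that by (simp add: flip_def)
  show "majorana a (2 * x + 1) *\<^sub>v fock_ket N a \<Omega> p =
      (- 1) ^ occ x p \<cdot>\<^sub>v fock_ket N a \<Omega> (flip x p)"
    using anticomm_tail_ket[OF majorana_carrier(1)[OF x] p flip_configs[OF p] X anti(1) agree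
        majorana_tail_ket(1)[OF p x], of 1]
    by (simp only: fock_ket_tail sum_occ) simp
  show "majorana a (2 * x + 2) *\<^sub>v fock_ket N a \<Omega> p =
      (\<i> * (- 1) ^ occ (Suc x) p) \<cdot>\<^sub>v fock_ket N a \<Omega> (flip x p)"
    using anticomm_tail_ket[OF majorana_carrier(2)[OF x] p flip_configs[OF p] X anti(2) agree
        majorana_tail_ket(2)[OF p x], of 1]
    by (simp only: fock_ket_tail sum_occ) (simp add: occ_def power_add mult_ac)
qed

end

subsection \<open>The Majorana translations\<close>

lemma flip_nth: "y < length p \<Longrightarrow> flip x p ! y = (if y = x then 1 - p ! y else p ! y)"
  by (auto simp: flip_def nth_list_update)

lemma flip_flip:
  assumes p: "p \<in> configs site_labels N" and x: "x < N"
  shows "flip x (flip x p) = p"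
proof (rule nth_equalityI)
  fix y assume "y < length (flip x (flip x p))"
  then have y: "y < N" using configs_length[OF p] by (simp add: flip_def)
  show "flip x (flip x p) ! y = p ! y"
    using configs_nth[OF p y] y configs_length[OF p] configs_length[OF flip_configs[OF p, of x]]
    by (auto simp: flip_nth)
qed (simp add: flip_def)

lemma sum_flip:
  fixes G :: "nat list \<Rightarrow> 'b :: comm_monoid_add"
  assumes "x < N"
  shows "(\<Sum>p\<in>configs site_labels N. G (flip x p)) = (\<Sum>p\<in>configs site_labels N. G p)"
  by (rule sum.reindex_bij_witness[of _ "flip x" "flip x"])
    (use assms in \<open>auto simp: flip_flip flip_configs simp del: One_nat_def\<close>)

lemma occ_flip:
  assumes p: "p \<in> configs site_labels N" and x: "x < N" and k: "k \<le> N"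
  shows "(- 1 :: complex) ^ occ k (flip x p) = (if x < k then - 1 else 1) * (- 1) ^ occ k p"
proof -
  have "(- 1 :: complex) ^ (flip x p ! y) = (if y = x then - 1 else 1) * (- 1) ^ (p ! y)" if "y < k" for y
    using that k configs_nth[OF p, of y] configs_length[OF p] by (auto simp: flip_nth)
  then have "(- 1 :: complex) ^ occ k (flip x p) =
      (\<Prod>y<k. (if y = x then - 1 else 1) * (- 1) ^ (p ! y))"
    by (simp add: occ_def power_sum)
  also have "\<dots> = (if x < k then - 1 else 1) * (- 1) ^ occ k p"
    by (simp add: prod.distrib occ_def power_sum)
  finally show ?thesis .
qed

text \<open>Used with \<open>w\<close> equal to \<open>\<i>\<close> or \<open>- \<i>\<close>: for a
  square root of \<open>- 1\<close> and an occupation \<open>b\<close> in {0, 1},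
  \<open>w ^ (1 - b) = w * (- 1) ^ b * w ^ b\<close>.\<close>

lemma power_occ_flip:
  fixes w :: complex
  assumes w: "w * w = - 1" and p: "p \<in> configs site_labels N" and x: "x < N"
  shows "w ^ occ N (flip x p) = w * (- 1) ^ (p ! x) * w ^ occ N p"
proof -
  have "w ^ (flip x p ! y) = (if y = x then w * (- 1) ^ (p ! x) else 1) * w ^ (p ! y)" if "y < N" for y
    using that configs_nth[OF p, of y] configs_length[OF p] w by (auto simp: flip_nth)
  then have "w ^ occ N (flip x p) =
      (\<Prod>y<N. (if y = x then w * (- 1) ^ (p ! x) else 1) * w ^ (p ! y))"
    by (simp add: occ_def power_sum)
  also have "\<dots> = w * (- 1) ^ (p ! x) * w ^ occ N p"
    using x by (simp add: prod.distrib occ_def power_sum)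
  finally show ?thesis .
qed

lemma occ_Suc: "occ (Suc k) p = occ k p + p ! k"
  by (simp add: occ_def)

section \<open>Fermionic signs under occupation flips\<close>

lemma fermi_sign_occ:
  assumes "ms \<in> configs site_labels N"
  shows "fermi_sign site_parity ns ms = (\<Prod>x<N. (- 1) ^ ((ns ! x + ms ! x) * occ x ms))"
  using configs_length[OF assms]
  by (simp add: fermi_sign_def fermi_exponent_def site_parity_def occ_def)

text \<open>A row label enters only the factor of its own site, whose exponent changes by an odd
  multiple of \<open>occ x m\<close>.\<close>

lemma fermi_sign_flip_left:
  assumes n: "n \<in> configs site_labels N" and m: "m \<in> configs site_labels N" and x: "x < N"
  shows "fermi_sign site_parity (flip x n) m = (- 1) ^ occ x m * fermi_sign site_parity n m"
proof -
  have "(- 1 :: complex) ^ ((flip x n ! z + m ! z) * occ z m) =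
      (if z = x then (- 1) ^ occ x m else 1) * (- 1) ^ ((n ! z + m ! z) * occ z m)" if "z < N" for z
    using that configs_nth[OF n, of z] configs_length[OF n]
    by (auto simp: flip_nth power_add ring_distribs)
  then have "fermi_sign site_parity (flip x n) m =
      (\<Prod>z<N. (if z = x then (- 1) ^ occ x m else 1) * (- 1) ^ ((n ! z + m ! z) * occ z m))"
    by (simp add: fermi_sign_occ[OF m])
  also have "\<dots> = (- 1) ^ occ x m * fermi_sign site_parity n m"
    using x by (simp add: prod.distrib fermi_sign_occ[OF m])
  finally show ?thesis .
qed

lemma occ_tail_sign:
  assumes x: "x < N"
  shows "(- 1 :: complex) ^ occ N p * (- 1) ^ occ (Suc x) p = (\<Prod>z\<in>{Suc x..<N}. (- 1) ^ (p ! z))"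
proof -
  have "occ N p = occ (Suc x) p + (\<Sum>z=Suc x..<N. p ! z)"
    using x unfolding occ_def lessThan_atLeast0 by (subst sum.atLeastLessThan_concat) auto
  then show ?thesis by (simp add: power_add power_sum flip: power2_eq_square power_mult)
qed

lemma fermi_sign_flip_right:
  assumes n: "n \<in> configs site_labels N" and m: "m \<in> configs site_labels N" and x: "x < N"
  shows "fermi_sign site_parity n (flip x m) =
    (- 1) ^ occ x m * ((- 1) ^ occ N n * (- 1) ^ occ (Suc x) n) *
      ((- 1) ^ occ N m * (- 1) ^ occ (Suc x) m) * fermi_sign site_parity n m"
proof -
  \<comment> \<open>The change at each site: nothing to the left of \<open>x\<close>; at
    \<open>x\<close> the local parity is flipped, giving the string of \<open>m\<close>; to the
    right the string itself changes by one particle, giving the local parity of \<open>n\<close> and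
    \<open>m\<close>.\<close>
  let ?g = "\<lambda>z. if z = x then (- 1) ^ occ x m else if z < x then 1 else (- 1) ^ (n ! z + m ! z) :: complex"
  have "(- 1 :: complex) ^ ((n ! z + flip x m ! z) * occ z (flip x m)) =
      ?g z * (- 1) ^ ((n ! z + m ! z) * occ z m)" if z: "z < N" for z
  proof -
    have "(- 1 :: complex) ^ ((n ! z + flip x m ! z) * occ z (flip x m)) =
        ((if x < z then - 1 else 1) * (- 1) ^ occ z m) ^ (n ! z + flip x m ! z)"
      using occ_flip[OF m x, of z] z by (simp add: power_mult mult.commute[of "n ! z + _"])
    also have "\<dots> = ?g z * (- 1) ^ ((n ! z + m ! z) * occ z m)"
      using z configs_nth[OF m z] configs_length[OF m]
      by (auto simp: flip_nth power_mult_distrib power_add ring_distribs power_mult mult.commute[of "n ! z"])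
    finally show ?thesis .
  qed
  then have "fermi_sign site_parity n (flip x m) =
      (\<Prod>z<N. ?g z) * fermi_sign site_parity n m"
    by (simp add: fermi_sign_occ[OF m] fermi_sign_occ[OF flip_configs[OF m]] prod.distrib)
  also have "(\<Prod>z<N. ?g z) = (- 1) ^ occ x m * (\<Prod>z\<in>{Suc x..<N}. (- 1) ^ (n ! z + m ! z))"
  proof -
    have "(\<Prod>z<N. ?g z) = (\<Prod>z<x. ?g z) * (?g x * (\<Prod>z\<in>{Suc x..<N}. ?g z))"
      using x prod.atLeastLessThan_concat[of 0 x N ?g] prod.atLeast_Suc_lessThan[of x N ?g]
      by (simp add: lessThan_atLeast0)
    also have "(\<Prod>z<x. ?g z) = 1" by (intro prod.neutral) auto
    also have "(\<Prod>z\<in>{Suc x..<N}. ?g z) = (\<Prod>z\<in>{Suc x..<N}. (- 1) ^ (n ! z + m ! z))"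
      by (intro prod.cong) auto
    finally show ?thesis by simp
  qed
  finally show ?thesis
    by (simp add: occ_tail_sign[OF x] power_add prod.distrib mult_ac)
qed

text \<open>The parameter \<open>e\<close> is \<open>0\<close> in the antiperiodic and \<open>1\<close> in the periodic case.\<close>

definition shift_elem :: "nat \<Rightarrow> nat \<Rightarrow> nat list \<Rightarrow> nat list \<Rightarrow> complex" where
  "shift_elem N e n m = 2 * complex_of_real (1 / sqrt 2) ^ (N + 1) * (\<i> * (- 1) ^ e) ^ occ N m *
     ((1 + (- 1) ^ (e + occ N n + occ N m)) / 2) * fermi_sign site_parity n m"

text \<open>The entry formula with the opposite parity projector. One flip leads from
  \<open>shift_elem\<close> to this quantity, so it is the common factor of both sides of each
  intertwining relation. The phase base \<open>\<i> * (- 1) ^ e\<close> is \<open>\<i>\<close> or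
  \<open>- \<i>\<close>, as in the two tensors.\<close>

definition odd_shift_elem :: "nat \<Rightarrow> nat \<Rightarrow> nat list \<Rightarrow> nat list \<Rightarrow> complex" where
  "odd_shift_elem N e n m = 2 * complex_of_real (1 / sqrt 2) ^ (N + 1) * (\<i> * (- 1) ^ e) ^ occ N m *
     ((1 - (- 1) ^ (e + occ N n + occ N m)) / 2) * fermi_sign site_parity n m"

lemma neg_one_power_cases: "(- 1 :: complex) ^ k = 1 \<or> (- 1 :: complex) ^ k = - 1"
  by (cases "even k") auto

lemma neg_one_power_square [simp]: "(- 1 :: complex) ^ k * (- 1) ^ k = 1"
  using neg_one_power_cases[of k] by auto

text \<open>The strings of \<open>m\<close> cancel against the local phase, and the projector sets
  \<open>(- 1) ^ (e + occ N n + occ N m)\<close> to \<open>- 1\<close>. Only the string of the row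
  \<open>n\<close> remains, which is how a column flip comes to look like a Majorana operator acting
  on the row.\<close>

lemma shift_elem_flip_right:
  assumes n: "n \<in> configs site_labels N" and m: "m \<in> configs site_labels N" and x: "x < N"
  shows "shift_elem N e n (flip x m) = - (\<i> * (- 1) ^ occ (Suc x) n) * odd_shift_elem N e n m"
proof -
  have "(\<i> * (- 1) ^ e) * (\<i> * (- 1) ^ e) = (- 1 :: complex)"
    using neg_one_power_cases[of e] by auto
  note pw = power_occ_flip[OF this m x]
  have sgn: "(- 1 :: complex) ^ (e + occ N n + occ N (flip x m)) = - ((- 1) ^ (e + occ N n + occ N m))"
    using occ_flip[OF m x, of N] x by (simp add: power_add)
  show ?thesis
    unfolding shift_elem_def odd_shift_elem_def pw sgn fermi_sign_flip_right[OF n m x] occ_Suc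
    using neg_one_power_cases[of e] neg_one_power_cases[of "occ N n"] neg_one_power_cases[of "occ N m"]
      neg_one_power_cases[of "occ x m"] neg_one_power_cases[of "m ! x"]
    by (auto simp: power_add)
qed

lemma shift_elem_flip_left:
  assumes n: "n \<in> configs site_labels N" and m: "m \<in> configs site_labels N" and x: "x < N"
  shows "shift_elem N e (flip x n) m = (- 1) ^ occ x m * odd_shift_elem N e n m"
proof -
  have "(- 1 :: complex) ^ (e + occ N (flip x n) + occ N m) = - ((- 1) ^ (e + occ N n + occ N m))"
    using occ_flip[OF n x, of N] x by (simp add: power_add)
  then show ?thesis
    unfolding shift_elem_def odd_shift_elem_def fermi_sign_flip_left[OF n m x] by simp
qed

text \<open>Two flips preserve the total parity, and the neighbouring strings of \<open>m\<close>
  differ exactly by the occupation of \<open>z\<close>. This sign separates columns that differ at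
  \<open>z\<close>.\<close>

lemma shift_elem_flip_two:
  assumes n: "n \<in> configs site_labels N" and m: "m \<in> configs site_labels N" and z: "Suc z < N"
  shows "shift_elem N e (flip z (flip (Suc z) n)) m = (- 1) ^ (m ! z) * shift_elem N e n m"
proof -
  have z': "z < N" using z by simp
  note fn = flip_configs[OF n, of "Suc z"]
  have "(- 1 :: complex) ^ (e + occ N (flip (Suc z) n) + occ N m) = - ((- 1) ^ (e + occ N n + occ N m))"
    using occ_flip[OF n z, of N] z by (simp add: power_add)
  then show ?thesis
    unfolding shift_elem_flip_left[OF fn m z'] occ_Suc
    unfolding shift_elem_def odd_shift_elem_def fermi_sign_flip_left[OF n m z] occ_Suc using neg_one_power_cases[of "occ z m"] by (auto simp: power_add)
qed

lemma fermi_sign_square: "fermi_sign par n m * fermi_sign par n m = 1"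
  by (simp add: fermi_sign_def flip: prod.distrib)

lemma cnj_fermi_sign: "cnj (fermi_sign par n m) = fermi_sign par n m"
  by (simp add: fermi_sign_def)

text \<open>All phases have modulus one and the projector is idempotent, so all allowed entries have
  the same modulus.\<close>

lemma shift_elem_norm:
  "cnj (shift_elem N e n m) * shift_elem N e n m =
    2 / 2 ^ N * ((1 + (- 1) ^ (e + occ N n + occ N m)) / 2)"
proof -
  let ?r = "complex_of_real (1 / sqrt 2)"
  let ?t = "(- 1 :: complex) ^ (e + occ N n + occ N m)"
  have r: "?r * ?r = 1 / 2"
    by (simp flip: of_real_mult)
  have "?r ^ (N + 1) * ?r ^ (N + 1) = (1 / 2) ^ (N + 1)"
    by (simp only: r flip: power_mult_distrib)
  moreover have "(- \<i> * (- 1) ^ e) ^ occ N m * (\<i> * (- 1) ^ e) ^ occ N m = (1 :: complex)"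
    using neg_one_power_cases[of e] by (auto simp flip: power_mult_distrib)
  moreover have "((1 + ?t) / 2) * ((1 + ?t) / 2) = (1 + ?t) / 2"
    using neg_one_power_cases[of "e + occ N n + occ N m"] by auto
  moreover have "cnj (shift_elem N e n m) * shift_elem N e n m =
      4 * (?r ^ (N + 1) * ?r ^ (N + 1)) * ((- \<i> * (- 1) ^ e) ^ occ N m * (\<i> * (- 1) ^ e) ^ occ N m) *
      (((1 + ?t) / 2) * ((1 + ?t) / 2)) * (fermi_sign site_parity n m * fermi_sign site_parity n m)"
    unfolding shift_elem_def by (simp add: cnj_fermi_sign mult_ac)
  ultimately have "cnj (shift_elem N e n m) * shift_elem N e n m =
      4 * (1 / 2) ^ (N + 1) * 1 * ((1 + ?t) / 2) * 1"
    by (simp only: fermi_sign_square)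
  also have "\<dots> = 2 / 2 ^ N * ((1 + ?t) / 2)"
    by (simp add: power_divide)
  finally show ?thesis .
qed

lemma shift_elem_columns:
  assumes N: "N \<ge> 1" and m: "m \<in> configs site_labels N" and m': "m' \<in> configs site_labels N"
  shows "(\<Sum>n\<in>configs site_labels N. cnj (shift_elem N e n m) * shift_elem N e n m') =
    (if m = m' then 1 else 0)"
proof (cases "m = m'")
  case True
  let ?C = "configs site_labels N"
  let ?t = "\<lambda>n. (- 1 :: complex) ^ (e + occ N n + occ N m)"
  \<comment> \<open>Flipping the first site pairs even with odd rows, so exactly half of the rows
    pass the projector; this needs at least one site.\<close>
  have "(\<Sum>n\<in>?C. ?t n) = (\<Sum>n\<in>?C. ?t (flip 0 n))"
    using N sum_flip[of 0 N ?t] by simp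
  also have "\<dots> = (\<Sum>n\<in>?C. - ?t n)"
    using N occ_flip[of _ N 0 N] by (intro sum.cong) (auto simp: power_add)
  finally have zero: "(\<Sum>n\<in>?C. ?t n) = 0" by (simp add: sum_negf)
  have "(\<Sum>n\<in>?C. cnj (shift_elem N e n m) * shift_elem N e n m) =
      2 / 2 ^ N * ((of_nat (card ?C) + (\<Sum>n\<in>?C. ?t n)) / 2)"
    unfolding shift_elem_norm
    by (simp add: sum.distrib sum_distrib_left[symmetric] sum_divide_distrib[symmetric])
  also have "\<dots> = 1"
    unfolding zero by (simp add: card_configs numeral_2_eq_2)
  finally show ?thesis using True by simp
next
  case False
  let ?C = "configs site_labels N"
  let ?G = "\<lambda>n. cnj (shift_elem N e n m) * shift_elem N e n m'"
  have len: "length m = N" "length m' = N" using configs_length m m' by auto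
  have m01: "m ! y \<in> {0, 1}" "m' ! y \<in> {0, 1}" if "y < N" for y
    using configs_nth m m' that by blast+
  show ?thesis
  proof (cases "\<exists>z. Suc z < N \<and> m ! z \<noteq> m' ! z")
    case True
    then obtain z where z: "Suc z < N" "m ! z \<noteq> m' ! z" by auto
    \<comment> \<open>Reindexing the rows by both flips multiplies each summand by
      \<open>(- 1) ^ (m ! z + m' ! z) = - 1\<close>, so the sum is its own negative.\<close>
    have "(\<Sum>n\<in>?C. ?G n) = (\<Sum>n\<in>?C. ?G (flip z n))"
      using sum_flip[of z N ?G] z by simp
    also have "\<dots> = (\<Sum>n\<in>?C. ?G (flip z (flip (Suc z) n)))"
      using sum_flip[of "Suc z" N "\<lambda>n. ?G (flip z n)"] z by simp
    also have "\<dots> = (\<Sum>n\<in>?C. - ?G n)"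
    proof (rule sum.cong)
      fix n assume n: "n \<in> ?C"
      show "?G (flip z (flip (Suc z) n)) = - ?G n"
        unfolding shift_elem_flip_two[OF n m z(1)] shift_elem_flip_two[OF n m' z(1)]
        using m01[of z] z by auto
    qed simp
    finally have "(\<Sum>n\<in>?C. ?G n) = 0" by (simp add: sum_negf)
    then show ?thesis using \<open>m \<noteq> m'\<close> by simp
  next
    \<comment> \<open>The last site has no right neighbour to flip with. Columns that differ only
      there have opposite parities, so no row is allowed in both and every summand vanishes.\<close>
    case agree: False
    define k where "k = N - 1"
    have k: "N = Suc k" using N by (simp add: k_def)
    have eq: "m ! y = m' ! y" if "y < k" for y using agree that k by auto
    then have neq: "m ! k \<noteq> m' ! k"
      using False len k by (metis less_antisym nth_equalityI)
    have "occ k m = occ k m'" using eq by (simp add: occ_def)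
    then have "(- 1 :: complex) ^ occ N m = - ((- 1) ^ occ N m')"
      using neq m01[of k] by (auto simp: k occ_Suc power_add)
    then have "?G n = 0" for n
      using neg_one_power_cases[of e] neg_one_power_cases[of "occ N n"]
        neg_one_power_cases[of "occ N m'"]
      by (auto simp: shift_elem_def power_add)
    then show ?thesis using False by simp
  qed
qed

lemma smult_mat_mult_vec:
  fixes A :: "'a :: comm_semiring_0 mat"
  assumes "A \<in> carrier_mat n m" "v \<in> carrier_vec m"
  shows "(c \<cdot>\<^sub>m A) *\<^sub>v v = c \<cdot>\<^sub>v (A *\<^sub>v v)"
  using assms by (intro eq_vecI) (auto simp: scalar_prod_def sum_distrib_left mult.assoc)

section \<open>From matrix entries to operator identities\<close>

locale majorana_shift = fock_space +
  fixes M :: "complex mat" and e :: nat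
  assumes N: "N \<ge> 1" and M: "M \<in> carrier_mat (2 ^ N) (2 ^ N)"
    and elem: "\<And>n m. n \<in> configs site_labels N \<Longrightarrow> m \<in> configs site_labels N \<Longrightarrow>
      mat_elem M (fock_ket N a \<Omega> n) (fock_ket N a \<Omega> m) = shift_elem N e n m"
begin

sublocale ket_basis d C "fock_ket N a \<Omega>"
  by (rule ket_basis)

lemma adjoint_M_M: "mat_adjoint M * M = 1\<^sub>m d"
proof (rule mat_elem_ext)
  fix p q assume p: "p \<in> C" and q: "q \<in> C"
  have one: "mat_elem (1\<^sub>m d) (fock_ket N a \<Omega> p) (fock_ket N a \<Omega> q) = (if p = q then 1 else 0)"
    using orth[OF q p] by (simp add: mat_elem_def one_mult_mat_vec[OF dim[OF q]] eq_commute)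
  have "mat_elem (mat_adjoint M * M) (fock_ket N a \<Omega> p) (fock_ket N a \<Omega> q) =
      (\<Sum>n\<in>C. cnj (shift_elem N e n p) * shift_elem N e n q)"
    unfolding mat_elem_mult[OF mat_adjoint_carrier[OF M] M dim[OF p] dim[OF q]]
    by (intro sum.cong refl) (simp only: mat_elem_adjoint[OF M dim[OF p] dim] elem p q)
  then show "mat_elem (mat_adjoint M * M) (fock_ket N a \<Omega> p) (fock_ket N a \<Omega> q) =
      mat_elem (1\<^sub>m d) (fock_ket N a \<Omega> p) (fock_ket N a \<Omega> q)"
    using shift_elem_columns[OF N p q] one by simp
qed (use mult_carrier_mat[OF mat_adjoint_carrier[OF M] M] in auto)

lemma M_adjoint_M: "M * mat_adjoint M = 1\<^sub>m d"
  by (rule mat_mult_left_right_inverse[OF mat_adjoint_carrier[OF M] M adjoint_M_M])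

lemma unitary: "unitary_mat d M"
  by (simp add: unitary_mat_def M adjoint_M_M M_adjoint_M)

text \<open>Unitarity reduces the claim to \<open>M * A = B * M\<close>. Since \<open>A\<close> and
  \<open>B\<close> each map a basis ket to a multiple of another one, both sides have a single
  contributing entry of \<open>M\<close>, compared in \<open>fg\<close>.\<close>

lemma conjugation:
  assumes A: "A \<in> carrier_mat d d" and B: "B \<in> carrier_mat d d" and x: "x < N" and y: "y < N"
    and Ak: "\<And>p. p \<in> C \<Longrightarrow> A *\<^sub>v fock_ket N a \<Omega> p = f p \<cdot>\<^sub>v fock_ket N a \<Omega> (flip x p)"
    and Bk: "\<And>p. p \<in> C \<Longrightarrow> B *\<^sub>v fock_ket N a \<Omega> p = g p \<cdot>\<^sub>v fock_ket N a \<Omega> (flip y p)"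
    and fg: "\<And>n p. n \<in> C \<Longrightarrow> p \<in> C \<Longrightarrow>
      f p * shift_elem N e n (flip x p) = g (flip y n) * shift_elem N e (flip y n) p"
  shows "M * A * mat_adjoint M = B"
proof -
  have "M * A = B * M"
  proof (rule mat_elem_ext)
    fix n p assume n: "n \<in> C" and p: "p \<in> C"
    let ?k = "fock_ket N a \<Omega>"
    have kx: "?k (flip x p) \<in> carrier_vec d" by (rule dim[OF flip_configs[OF p]])
    have "(M * A) *\<^sub>v ?k p = f p \<cdot>\<^sub>v (M *\<^sub>v ?k (flip x p))"
      using assoc_mult_mat_vec[OF M A dim[OF p]] Ak[OF p] mult_mat_vec[OF M kx] by simp
    then have "mat_elem (M * A) (?k n) (?k p) = f p * mat_elem M (?k n) (?k (flip x p))"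
      using M kx dim[OF n] by (simp add: mat_elem_def)
    also have "\<dots> = f p * shift_elem N e n (flip x p)"
      by (simp only: elem[OF n flip_configs[OF p]])
    finally have L: "mat_elem (M * A) (?k n) (?k p) = f p * shift_elem N e n (flip x p)" .
    have "mat_elem B (?k n) (?k q) * mat_elem M (?k q) (?k p) =
        (if q = flip y n then g (flip y n) * shift_elem N e (flip y n) p else 0)" if q: "q \<in> C" for q
    proof -
      have "mat_elem B (?k n) (?k q) = g q * (if flip y q = n then 1 else 0)"
        using Bk[OF q] dim[OF flip_configs[OF q]] dim[OF n] orth[OF flip_configs[OF q] n]
        by (simp add: mat_elem_def)
      \<comment> \<open>Flips are involutions, so the sum over intermediate kets in
        \<open>B * M\<close> collapses to one term.\<close>
      moreover have "flip y q = n \<longleftrightarrow> q = flip y n"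
        using flip_flip[OF q y] flip_flip[OF n y] by auto
      ultimately show ?thesis using elem[OF q p] by auto
    qed
    then have "mat_elem (B * M) (?k n) (?k p) = g (flip y n) * shift_elem N e (flip y n) p"
      unfolding mat_elem_mult[OF B M dim[OF n] dim[OF p]]
      using finC flip_configs[OF n, of y] by simp
    with L fg[OF n p] show "mat_elem (M * A) (?k n) (?k p) = mat_elem (B * M) (?k n) (?k p)" by simp
  qed (use mult_carrier_mat[OF M A] mult_carrier_mat[OF B M] in auto)
  then have "M * A * mat_adjoint M = B * (M * mat_adjoint M)"
    using assoc_mult_mat[OF B M mat_adjoint_carrier[OF M]] by simp
  then show ?thesis using M_adjoint_M B by simp
qed

text \<open>Both Majorana operators live on the same site, and the string of the image includes that
  site, so the row flip supplies the minus sign from the column flip.\<close>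

lemma shift_odd:
  assumes x: "x < N"
  shows "M * majorana a (2 * x + 1) * mat_adjoint M = majorana a (2 * x + 2)"
proof (rule conjugation[OF majorana_carrier[OF x] x x majorana_fock_ket(1)[OF _ x] majorana_fock_ket(2)[OF _ x]])
  fix n p assume n: "n \<in> C" and p: "p \<in> C"
  show "(- 1) ^ occ x p * shift_elem N e n (flip x p) =
      \<i> * (- 1) ^ occ (Suc x) (flip x n) * shift_elem N e (flip x n) p"
    unfolding shift_elem_flip_left[OF n p x] shift_elem_flip_right[OF n p x]
    using occ_flip[OF n x, of "Suc x"] x by simp
qed auto

text \<open>The image lives on the next site, whose flip lies outside the string
  \<open>occ (Suc x)\<close>. The two factors \<open>\<i>\<close> cancel the minus sign.\<close>

lemma shift_even:
  assumes x: "Suc x < N"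
  shows "M * majorana a (2 * x + 2) * mat_adjoint M = majorana a (2 * Suc x + 1)"
proof -
  have x': "x < N" using x by simp
  show ?thesis
  proof (rule conjugation[OF majorana_carrier(2)[OF x'] majorana_carrier(1)[OF x] x' x
        majorana_fock_ket(2)[OF _ x'] majorana_fock_ket(1)[OF _ x]])
    fix n p assume n: "n \<in> C" and p: "p \<in> C"
    show "\<i> * (- 1) ^ occ (Suc x) p * shift_elem N e n (flip x p) =
        (- 1) ^ occ (Suc x) (flip (Suc x) n) * shift_elem N e (flip (Suc x) n) p"
      unfolding shift_elem_flip_left[OF n p x] shift_elem_flip_right[OF n p x']
      using occ_flip[OF n x, of "Suc x"] x by (simp add: mult_ac)
  qed auto
qed

text \<open>Here the string of the source and the string produced by the column flip both extend
  over the whole chain. Their product is the total parity of row and column, which the projector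
  fixes to \<open>- ((- 1) ^ e)\<close>.\<close>

lemma shift_last:
  "M * majorana a (2 * N) * mat_adjoint M = (- ((- 1) ^ e)) \<cdot>\<^sub>m majorana a 1"
proof -
  define x where "x = N - 1"
  have x: "x < N" and Nx: "N = Suc x" using N by (auto simp: x_def)
  have o: "0 < N" using N by simp
  have m1: "majorana a 1 \<in> carrier_mat d d" using majorana_carrier(1)[OF o] by simp
  have "M * majorana a (2 * x + 2) * mat_adjoint M = (- ((- 1) ^ e)) \<cdot>\<^sub>m majorana a 1"
  proof (rule conjugation[OF majorana_carrier(2)[OF x] _ x o majorana_fock_ket(2)[OF _ x]])
    fix p assume p: "p \<in> C"
    show "(- ((- 1) ^ e)) \<cdot>\<^sub>m majorana a 1 *\<^sub>v fock_ket N a \<Omega> p =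
        (- ((- 1) ^ e)) \<cdot>\<^sub>v fock_ket N a \<Omega> (flip 0 p)"
      using majorana_fock_ket(1)[OF p o] smult_mat_mult_vec[OF m1 dim[OF p]]
      by (simp add: occ_def)
  next
    fix n p assume n: "n \<in> C" and p: "p \<in> C"
    show "\<i> * (- 1) ^ occ (Suc x) p * shift_elem N e n (flip x p) =
        - ((- 1) ^ e) * shift_elem N e (flip 0 n) p"
      unfolding shift_elem_flip_left[OF n p o] shift_elem_flip_right[OF n p x] Nx[symmetric]
      using neg_one_power_cases[of e] neg_one_power_cases[of "occ N n"]
        neg_one_power_cases[of "occ N p"]
      by (auto simp: odd_shift_elem_def power_add occ_def)
  qed (use m1 in auto)
  then show ?thesis by (simp add: Nx)
qed

lemma shift:
  assumes j: "1 \<le> j" "j \<le> 2 * N - 1"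
  shows "M * majorana a j * mat_adjoint M = majorana a (j + 1)"
proof (cases "odd j")
  case True
  then obtain x where "j = 2 * x + 1" by (auto elim: oddE)
  then show ?thesis using shift_odd[of x] j by simp
next
  case False
  then obtain y where "j = 2 * y" by (auto elim: evenE)
  then obtain x where x: "j = 2 * x + 2" using j by (cases y) auto
  then show ?thesis using shift_even[of x] j by simp
qed

end

subsection \<open>Coefficients and blocking\<close>

lemma sigma_x_carrier [simp]: "sigma_x \<in> carrier_mat 2 2"
  by (intro carrier_matI) (simp_all add: sigma_x_def mat_of_rows_list_def)

lemma sigma_x_square: "sigma_x * sigma_x = 1\<^sub>m 2"
  by (rule eq_matI)
    (auto simp: scalar_prod_def sigma_x_def mat_of_rows_list_def less_2_cases_iff)

lemma sigma_x_pow: "sigma_x ^\<^sub>m k = (if even k then 1\<^sub>m 2 else sigma_x)"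
  using carrier_matD[OF sigma_x_carrier] left_mult_one_mat[OF sigma_x_carrier]
  by (induction k) (auto simp: sigma_x_square)

lemma sigma_x_pow_mult: "sigma_x ^\<^sub>m j * sigma_x ^\<^sub>m k = sigma_x ^\<^sub>m (j + k)"
  using sigma_x_square left_mult_one_mat[OF sigma_x_carrier] right_mult_one_mat[OF sigma_x_carrier]
  by (auto simp: sigma_x_pow)

lemma mtrace_sigma_x_pow: "mtrace (sigma_x ^\<^sub>m k) = (if even k then 2 else 0)"
  by (simp add: sigma_x_pow mtrace_def)
    (simp add: sigma_x_def mat_of_rows_list_def numeral_2_eq_2)

text \<open>All tensor components are multiples of powers of one matrix, so the product depends only
  on the total occupations. The values \<open>w = \<i>\<close> and \<open>w = - \<i>\<close> give
  the two tensors.\<close>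

lemma mat_prod_sigma_x:
  assumes "length ns = length ms"
  shows "mat_prod 2 (map2 (\<lambda>n m. (c * w ^ m) \<cdot>\<^sub>m (sigma_x ^\<^sub>m (n + m))) ns ms) =
    (c ^ length ms * w ^ sum_list ms) \<cdot>\<^sub>m sigma_x ^\<^sub>m (sum_list ns + sum_list ms)"
  using assms
proof (induction ns ms rule: list_induct2)
  case Nil
  show ?case by (intro eq_matI) (auto simp: sigma_x_def mat_of_rows_list_def)
next
  case (Cons n ns m ms)
  let ?S = "\<lambda>k. sigma_x ^\<^sub>m k"
  have S: "?S k \<in> carrier_mat 2 2" for k by simp
  have "(b \<cdot>\<^sub>m ?S j) * (b' \<cdot>\<^sub>m ?S k) = (b * b') \<cdot>\<^sub>m ?S (j + k)" for b b' j k
  proof -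
    have "(b \<cdot>\<^sub>m ?S j) * (b' \<cdot>\<^sub>m ?S k) = b \<cdot>\<^sub>m (b' \<cdot>\<^sub>m (?S j * ?S k))"
      using mult_smult_assoc_mat[OF S smult_carrier_mat[OF S]] mult_smult_distrib[OF S S] by simp
    also have "\<dots> = (b * b') \<cdot>\<^sub>m ?S (j + k)"
      by (auto simp: sigma_x_pow_mult mult.assoc)
    finally show ?thesis .
  qed
  then show ?case using Cons.IH by (simp add: power_add mult_ac add_ac)
qed

lemma sum_list_occ: "length p = N \<Longrightarrow> sum_list p = occ N p"
  by (auto simp: sum_list_sum_nth occ_def lessThan_atLeast0)

context fock_space
begin

lemma M_AP_elem:
  assumes n: "n \<in> C" and m: "m \<in> C"
  shows "mat_elem (M_AP N a \<Omega>) (fock_ket N a \<Omega> n) (fock_ket N a \<Omega> m) = shift_elem N 0 n m"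
proof -
  note len = configs_length[OF n] configs_length[OF m]
  have kets: "kets d C (fock_ket N a \<Omega>)"
    using ket_basis by (simp add: ket_basis_def)
  have fin: "finite site_labels" by simp
  have "mtrace (mat_prod 2 (map2 M_tensor n m)) = complex_of_real (1 / sqrt 2) ^ N * \<i> ^ occ N m *
      (if even (occ N n + occ N m) then 2 else 0)"
    using mat_prod_sigma_x[of n m "complex_of_real (1 / sqrt 2)" \<i>] len
    by (simp add: M_tensor_def[abs_def] mtrace_smult[of _ 2] mtrace_sigma_x_pow sum_list_occ)
  then show ?thesis
    unfolding M_AP_def mat_elem_f_sum[OF kets fin n m]
    by (cases "even (occ N n + occ N m)") (auto simp: shift_elem_def)
qed

text \<open>The additional \<open>sigma_x\<close> raises the exponent by one, so the trace selects
  odd instead of even total parity; this is the \<open>e\<close> inside the projector of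
  \<open>shift_elem\<close>.\<close>

lemma M_P_elem:
  assumes n: "n \<in> C" and m: "m \<in> C"
  shows "mat_elem (M_P N a \<Omega>) (fock_ket N a \<Omega> n) (fock_ket N a \<Omega> m) = shift_elem N 1 n m"
proof -
  note len = configs_length[OF n] configs_length[OF m]
  have kets: "kets d C (fock_ket N a \<Omega>)"
    using ket_basis by (simp add: ket_basis_def)
  have fin: "finite site_labels" by simp
  have "sigma_x * sigma_x ^\<^sub>m k = sigma_x ^\<^sub>m (Suc k)" for k
    using sigma_x_pow_mult[of 1 k] by (simp add: sigma_x_pow)
  then have "sigma_x * (b \<cdot>\<^sub>m sigma_x ^\<^sub>m k) = b \<cdot>\<^sub>m sigma_x ^\<^sub>m (Suc k)" for b k
    using mult_smult_distrib[OF sigma_x_carrier pow_carrier_mat[OF sigma_x_carrier], of b k]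
    by simp
  then have "mtrace (sigma_x * mat_prod 2 (map2 M_tilde_tensor n m)) =
      complex_of_real (1 / sqrt 2) ^ N * (- \<i>) ^ occ N m * (if odd (occ N n + occ N m) then 2 else 0)"
    using mat_prod_sigma_x[of n m "complex_of_real (1 / sqrt 2)" "- \<i>"] len
    by (simp add: M_tilde_tensor_def[abs_def] mtrace_smult[of _ 2] mtrace_sigma_x_pow sum_list_occ
        del: pow_mat.simps)
  then show ?thesis
    unfolding M_P_def mat_elem_f_sum[OF kets fin n m]
    by (cases "even (occ N n + occ N m)") (auto simp: shift_elem_def)
qed

lemma M_AP_shift: "N \<ge> 1 \<Longrightarrow> majorana_shift N a \<Omega> (M_AP N a \<Omega>) 0"
  by unfold_locales (assumption, simp add: M_AP_def, rule M_AP_elem)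

lemma M_P_shift: "N \<ge> 1 \<Longrightarrow> majorana_shift N a \<Omega> (M_P N a \<Omega>) 1"
  by unfold_locales (assumption, simp add: M_P_def, rule M_P_elem)

lemma vacuum_configs: "replicate N 0 \<in> C"
  by (auto simp: configs_def)

lemma M_AP_vacuum:
  "mat_elem (M_AP N a \<Omega>) (fock_ket N a \<Omega> (replicate N 0)) (fock_ket N a \<Omega> (replicate N 0)) =
    complex_of_real (sqrt 2) * complex_of_real (1 / sqrt 2) ^ N"
proof -
  have "occ N (replicate N 0) = 0" by (simp add: occ_def)
  moreover have "fermi_sign site_parity (replicate N 0) (replicate N 0) = 1"
    by (simp add: fermi_sign_def fermi_exponent_def site_parity_def)
  moreover have "complex_of_real (2 * (1 / sqrt 2)) = complex_of_real (sqrt 2)"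
    by (rule arg_cong) (simp add: real_div_sqrt)
  then have "2 * complex_of_real (1 / sqrt 2) = complex_of_real (sqrt 2)"
    by (simp only: of_real_mult of_real_numeral)
  then have "2 * complex_of_real (1 / sqrt 2) ^ (N + 1) =
      complex_of_real (sqrt 2) * complex_of_real (1 / sqrt 2) ^ N"
    by (simp only: power_add power_one_right mult.assoc mult.commute[of "_ ^ N"])
      (simp only: mult.assoc[symmetric])
  ultimately show ?thesis
    unfolding M_AP_elem[OF vacuum_configs vacuum_configs] shift_elem_def by simp
qed

text \<open>The vacuum column and the row with one particle at the first site form a pair of odd
  total parity, available at every length.\<close>

lemma M_P_odd_elem:
  assumes N: "N \<ge> 1"
  shows "1 # replicate (N - 1) 0 \<in> C"
    and "mat_elem (M_P N a \<Omega>) (fock_ket N a \<Omega> (1 # replicate (N - 1) 0))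
      (fock_ket N a \<Omega> (replicate N 0)) \<noteq> 0"
proof -
  let ?n = "1 # replicate (N - 1) 0 :: nat list"
  show n: "?n \<in> C" using N by (auto simp: configs_def)
  have "occ N (replicate N 0) = 0" "occ N ?n = 1"
    using N sum_list_occ[of ?n N] by (simp_all add: occ_def sum_list_replicate)
  moreover have "fermi_sign site_parity ?n (replicate N 0) \<noteq> 0"
    by (simp add: fermi_sign_def)
  ultimately show "mat_elem (M_P N a \<Omega>) (fock_ket N a \<Omega> ?n) (fock_ket N a \<Omega> (replicate N 0)) \<noteq> 0"
    unfolding M_P_elem[OF n vacuum_configs] shift_elem_def by simp
qed

end

section \<open>Blocking of neighbouring sites\<close>

lemma concat_block_configs:
  "ps \<in> configs (block_labels k) L \<Longrightarrow> concat ps \<in> configs site_labels (k * L)"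
proof (induction ps arbitrary: L)
  case Nil
  then show ?case by (simp add: configs_def)
next
  case (Cons b ps)
  then have "concat ps \<in> configs site_labels (k * (L - 1))" "L \<ge> 1" "b \<in> block_labels k"
    by (auto simp: configs_def)
  then show ?case by (cases L) (auto simp: configs_def block_labels_def)
qed

lemma block_kets:
  assumes modes: "fermion_modes (k * L) a \<Omega>"
  shows "kets (2 ^ (k * L)) (configs (block_labels k) L) (block_ket (k * L) a \<Omega>)"
proof -
  interpret fock_space "k * L" a \<Omega> by unfold_locales (rule modes)
  interpret ket_basis d C "fock_ket (k * L) a \<Omega>" by (rule ket_basis)
  show ?thesis
  proof
    fix p q assume p: "p \<in> configs (block_labels k) L" and q: "q \<in> configs (block_labels k) L"
    show "block_ket (k * L) a \<Omega> p \<in> carrier_vec d"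
      unfolding block_ket_def by (rule dim[OF concat_block_configs[OF p]])
    have len: "length b = k" if "b \<in> set p \<union> set q" for b
      using p q that by (auto simp: configs_def block_labels_def)
    \<comment> \<open>Concatenation is injective because all blocks have the same length
      \<open>k\<close>, so block kets inherit orthonormality from the Fock kets.\<close>
    have "concat p = concat q \<longleftrightarrow> p = q"
      using concat_injective[of p q] len configs_length[OF p] configs_length[OF q]
      by (auto dest: set_zip_leftD set_zip_rightD)
    then show "block_ket (k * L) a \<Omega> p \<bullet>c block_ket (k * L) a \<Omega> q = (if p = q then 1 else 0)"
      unfolding block_ket_def
      using orth[OF concat_block_configs[OF p] concat_block_configs[OF q]] by simp
  qed
qed

lemma finite_block_labels: "finite (block_labels k)"
  by (simp add: block_labels_def finite_configs)

lemma vacuum_block: "replicate k 0 \<in> block_labels k"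
  by (auto simp: block_labels_def configs_def)

lemma block_vacuum: "concat (replicate L (replicate k 0)) = replicate (k * L) (0 :: nat)"
  by (induction L) (simp_all add: replicate_add)

section \<open>Exclusion of plain fMPOs, for single sites and for blocks\<close>

lemma M_P_not_plain_periodic:
  assumes modes: "fermion_modes N a \<Omega>" and N: "N \<ge> 1"
  shows "\<not> (\<exists>D Z U. even_tensor site_labels site_parity D Z U \<and>
    M_P N a \<Omega> = plain_periodic_fMPO (2 ^ N) site_labels site_parity (fock_ket N a \<Omega>) N D Z U)"
proof -
  interpret fock_space N a \<Omega> by unfold_locales (rule modes)
  show ?thesis
    by (rule not_plain_periodic_if_odd_elem[OF _ _ M_P_odd_elem(1)[OF N] vacuum_configs _
          M_P_odd_elem(2)[OF N]])
      (use ket_basis in \<open>auto simp: ket_basis_def site_parity_def[abs_def] sum_list_replicate\<close>)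
qed

lemma M_P_not_plain_periodic_blocked:
  assumes modes: "fermion_modes (k * L) a \<Omega>" and k: "k \<ge> 1" and L: "L \<ge> 1"
  shows "\<not> (\<exists>D Z U. even_tensor (block_labels k) block_parity D Z U \<and>
    M_P (k * L) a \<Omega> = plain_periodic_fMPO (2 ^ (k * L)) (block_labels k) block_parity
      (block_ket (k * L) a \<Omega>) L D Z U)"
proof -
  interpret fock_space "k * L" a \<Omega> by unfold_locales (rule modes)
  have N: "k * L \<ge> 1" using k L by simp
  let ?b = "replicate k 0 :: nat list"
  \<comment> \<open>The single-particle row cut into blocks: the first block is odd, all others are
    even, so the total block parity of row and column is again odd.\<close>
  let ?ns = "(1 # replicate (k - 1) 0) # replicate (L - 1) ?b"
  let ?ms = "replicate L ?b"
  have ns: "?ns \<in> configs (block_labels k) L" and ms: "?ms \<in> configs (block_labels k) L"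
    using k L by (auto simp: configs_def block_labels_def)
  obtain k' L' where kL: "k = Suc k'" "L = Suc L'" using k L by (metis Suc_le_D One_nat_def)
  have "concat ?ns = 1 # replicate (k * L - 1) 0"
    using block_vacuum[of L' k] by (simp add: kL flip: replicate_add)
  then have nz: "mat_elem (M_P (k * L) a \<Omega>) (block_ket (k * L) a \<Omega> ?ns) (block_ket (k * L) a \<Omega> ?ms) \<noteq> 0"
    using M_P_odd_elem(2)[OF N] by (simp add: block_ket_def block_vacuum)
  have "odd (sum_list (map block_parity ?ns) + sum_list (map block_parity ?ms))"
    by (simp add: block_parity_def sum_list_replicate)
  then show ?thesis
    by (rule not_plain_periodic_if_odd_elem[OF block_kets[OF modes] finite_block_labels ns ms _ nz])
qed

lemma M_AP_not_plain_antiperiodic: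
  assumes modes: "\<And>N. N \<ge> 1 \<Longrightarrow> fermion_modes N (a N) (\<Omega> N)"
  shows "\<not> (\<exists>D Z U. even_tensor site_labels site_parity D Z U \<and>
    (\<forall>N\<ge>1. M_AP N (a N) (\<Omega> N) =
      plain_antiperiodic_fMPO (2 ^ N) site_labels site_parity (fock_ket N (a N) (\<Omega> N)) N D U))"
proof (rule not_plain_antiperiodic_if_sqrt_2[where b = 0 and r = "complex_of_real (1 / sqrt 2)"])
  fix N :: nat assume "N \<ge> 1"
  then interpret fock_space N "a N" "\<Omega> N" by unfold_locales (rule modes)
  show "kets (2 ^ N) (configs site_labels N) (fock_ket N (a N) (\<Omega> N))"
    using ket_basis by (simp add: ket_basis_def)
  show "mat_elem (M_AP N (a N) (\<Omega> N)) (fock_ket N (a N) (\<Omega> N) (replicate N 0))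
      (fock_ket N (a N) (\<Omega> N) (replicate N 0)) =
    complex_of_real (sqrt 2) * complex_of_real (1 / sqrt 2) ^ N"
    by (rule M_AP_vacuum)
qed (auto simp: site_parity_def)

text \<open>The all-zero block serves as the even label. A chain of \<open>L\<close> blocks has
  \<open>k * L\<close> sites, so its vacuum entry is sqrt 2 times the \<open>L\<close>-th power of
  the \<open>k\<close>-th power of 1 / sqrt 2, and the coefficient remains sqrt 2.\<close>

lemma M_AP_not_plain_antiperiodic_blocked:
  assumes modes: "\<And>N. N \<ge> 1 \<Longrightarrow> fermion_modes N (a N) (\<Omega> N)" and k: "k \<ge> 1"
  shows "\<not> (\<exists>D Z U. even_tensor (block_labels k) block_parity D Z U \<and>
    (\<forall>L\<ge>1. M_AP (k * L) (a (k * L)) (\<Omega> (k * L)) =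
      plain_antiperiodic_fMPO (2 ^ (k * L)) (block_labels k) block_parity
        (block_ket (k * L) (a (k * L)) (\<Omega> (k * L))) L D U))"
proof (rule not_plain_antiperiodic_if_sqrt_2[where b = "replicate k 0" and
      r = "complex_of_real (1 / sqrt 2) ^ k" and d = "\<lambda>L. 2 ^ (k * L)" and
      ket = "\<lambda>L. block_ket (k * L) (a (k * L)) (\<Omega> (k * L))"])
  fix L :: nat assume "L \<ge> 1"
  then have m: "fermion_modes (k * L) (a (k * L)) (\<Omega> (k * L))" using k by (intro modes) simp
  then interpret fock_space "k * L" "a (k * L)" "\<Omega> (k * L)" by unfold_locales
  show "kets (2 ^ (k * L)) (configs (block_labels k) L) (block_ket (k * L) (a (k * L)) (\<Omega> (k * L)))"
    by (rule block_kets[OF m])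
  show "mat_elem (M_AP (k * L) (a (k * L)) (\<Omega> (k * L)))
      (block_ket (k * L) (a (k * L)) (\<Omega> (k * L)) (replicate L (replicate k 0)))
      (block_ket (k * L) (a (k * L)) (\<Omega> (k * L)) (replicate L (replicate k 0))) =
    complex_of_real (sqrt 2) * (complex_of_real (1 / sqrt 2) ^ k) ^ L"
    using M_AP_vacuum by (simp add: block_ket_def block_vacuum power_mult)
qed (auto simp: finite_block_labels vacuum_block block_parity_def sum_list_replicate)

theorem mainTheorem2:
  fixes a :: "nat \<Rightarrow> nat \<Rightarrow> complex mat" and \<Omega> :: "nat \<Rightarrow> complex vec"
  assumes modes: "\<And>N. N \<ge> 1 \<Longrightarrow> fermion_modes N (a N) (\<Omega> N)"
  shows
    "(\<forall>N\<ge>1.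
        unitary_mat (2 ^ N) (M_AP N (a N) (\<Omega> N)) \<and>
        unitary_mat (2 ^ N) (M_P N (a N) (\<Omega> N)) \<and>
        (\<forall>j. 1 \<le> j \<and> j \<le> 2 * N - 1 \<longrightarrow>
          M_AP N (a N) (\<Omega> N) * majorana (a N) j * mat_adjoint (M_AP N (a N) (\<Omega> N))
            = majorana (a N) (j + 1) \<and>
          M_P N (a N) (\<Omega> N) * majorana (a N) j * mat_adjoint (M_P N (a N) (\<Omega> N))
            = majorana (a N) (j + 1)) \<and>
        M_AP N (a N) (\<Omega> N) * majorana (a N) (2 * N) * mat_adjoint (M_AP N (a N) (\<Omega> N))
          = - majorana (a N) 1 \<and>
        M_P N (a N) (\<Omega> N) * majorana (a N) (2 * N) * mat_adjoint (M_P N (a N) (\<Omega> N))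
          = majorana (a N) 1)
     \<and>
     (\<forall>N\<ge>1. \<not> (\<exists>D Z U. even_tensor site_labels site_parity D Z U \<and>
        M_P N (a N) (\<Omega> N) =
          plain_periodic_fMPO (2 ^ N) site_labels site_parity
            (fock_ket N (a N) (\<Omega> N)) N D Z U))
     \<and>
     \<not> (\<exists>D Z U. even_tensor site_labels site_parity D Z U \<and>
        (\<forall>N\<ge>1. M_AP N (a N) (\<Omega> N) =
          plain_antiperiodic_fMPO (2 ^ N) site_labels site_parity
            (fock_ket N (a N) (\<Omega> N)) N D U))
     \<and>
     (\<forall>k\<ge>1. \<forall>L\<ge>1. \<not> (\<exists>D Z U. even_tensor (block_labels k) block_parity D Z U \<and>
        M_P (k * L) (a (k * L)) (\<Omega> (k * L)) =
          plain_periodic_fMPO (2 ^ (k * L)) (block_labels k) block_parity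
            (block_ket (k * L) (a (k * L)) (\<Omega> (k * L))) L D Z U))
     \<and>
     (\<forall>k\<ge>1. \<not> (\<exists>D Z U. even_tensor (block_labels k) block_parity D Z U \<and>
        (\<forall>L\<ge>1. M_AP (k * L) (a (k * L)) (\<Omega> (k * L)) =
          plain_antiperiodic_fMPO (2 ^ (k * L)) (block_labels k) block_parity
            (block_ket (k * L) (a (k * L)) (\<Omega> (k * L))) L D U)))"
proof (intro conjI allI impI)
  fix N :: nat assume N: "N \<ge> 1"
  interpret fock_space N "a N" "\<Omega> N" by unfold_locales (rule modes[OF N])
  interpret AP: majorana_shift N "a N" "\<Omega> N" "M_AP N (a N) (\<Omega> N)" 0 by (rule M_AP_shift[OF N])
  interpret P: majorana_shift N "a N" "\<Omega> N" "M_P N (a N) (\<Omega> N)" 1 by (rule M_P_shift[OF N])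
  show "unitary_mat (2 ^ N) (M_AP N (a N) (\<Omega> N))" by (rule AP.unitary)
  show "unitary_mat (2 ^ N) (M_P N (a N) (\<Omega> N))" by (rule P.unitary)
  show "M_AP N (a N) (\<Omega> N) * majorana (a N) (2 * N) * mat_adjoint (M_AP N (a N) (\<Omega> N)) =
      - majorana (a N) 1"
    unfolding AP.shift_last by (intro eq_matI) auto
  show "M_P N (a N) (\<Omega> N) * majorana (a N) (2 * N) * mat_adjoint (M_P N (a N) (\<Omega> N)) =
      majorana (a N) 1"
    unfolding P.shift_last by (intro eq_matI) auto
  fix j assume "1 \<le> j \<and> j \<le> 2 * N - 1"
  then have j: "1 \<le> j" "j \<le> 2 * N - 1" by auto
  show "M_AP N (a N) (\<Omega> N) * majorana (a N) j * mat_adjoint (M_AP N (a N) (\<Omega> N)) =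
      majorana (a N) (j + 1)"
    by (rule AP.shift[OF j])
  show "M_P N (a N) (\<Omega> N) * majorana (a N) j * mat_adjoint (M_P N (a N) (\<Omega> N)) =
      majorana (a N) (j + 1)"
    by (rule P.shift[OF j])
next
  fix N :: nat assume N: "N \<ge> 1"
  show "\<not> (\<exists>D Z U. even_tensor site_labels site_parity D Z U \<and>
      M_P N (a N) (\<Omega> N) =
        plain_periodic_fMPO (2 ^ N) site_labels site_parity (fock_ket N (a N) (\<Omega> N)) N D Z U)"
    by (rule M_P_not_plain_periodic[OF modes[OF N] N])
next
  show "\<not> (\<exists>D Z U. even_tensor site_labels site_parity D Z U \<and>
      (\<forall>N\<ge>1. M_AP N (a N) (\<Omega> N) =
        plain_antiperiodic_fMPO (2 ^ N) site_labels site_parity (fock_ket N (a N) (\<Omega> N)) N D U))"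
    using modes by (rule M_AP_not_plain_antiperiodic)
next
  fix k L :: nat assume k: "k \<ge> 1" and L: "L \<ge> 1"
  have "k * L \<ge> 1" using k L by simp
  from M_P_not_plain_periodic_blocked[OF modes[OF this] k L]
  show "\<not> (\<exists>D Z U. even_tensor (block_labels k) block_parity D Z U \<and>
      M_P (k * L) (a (k * L)) (\<Omega> (k * L)) =
        plain_periodic_fMPO (2 ^ (k * L)) (block_labels k) block_parity
          (block_ket (k * L) (a (k * L)) (\<Omega> (k * L))) L D Z U)" .
next
  fix k :: nat assume k: "k \<ge> 1"
  show "\<not> (\<exists>D Z U. even_tensor (block_labels k) block_parity D Z U \<and>
      (\<forall>L\<ge>1. M_AP (k * L) (a (k * L)) (\<Omega> (k * L)) =
        plain_antiperiodic_fMPO (2 ^ (k * L)) (block_labels k) block_parity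
          (block_ket (k * L) (a (k * L)) (\<Omega> (k * L))) L D U))"
    using modes k by (rule M_AP_not_plain_antiperiodic_blocked)
qed

end
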